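(* Let $p \geq 0$ and let $G$ be a simple graph with at least one edge. Then for each $X \in \{\chi_f(G), \chi_q(G), \xi(G)\}$, $$\chi(G) \geq X \geq \xi_f(G) \geq 1 + \max\left\{ \frac{\mathcal{E}_p^+(G)}{\mathcal{E}_p^-(G)}, \frac{\mathcal{E}_p^-(G)}{\mathcal{E}_p^+(G)} \right\}^{\frac{1}{|p - 1|}}.$$
   Context: Graphs are simple (undirected, no loops or multiple edges). $A_G$ is the adjacency matrix of $G$, with eigenvalues $\lambda_1 \ge \cdots \ge \lambda_n$. For $p \ge 0$, the positive and negative $p$-energies are $\mathcal{E}_p^+(G) = \sum_{\lambda_i > 0} \lambda_i^p$ and $\mathcal{E}_p^-(G) = \sum_{\lambda_i<0} |\lambda_i|^p$ (sums over eigenvalues with multiplicity; in particular $\mathcal{E}_0^+ = n^+$ and $\mathcal{E}_0^- = n^-$ are the numbers of positive and negative eigenvalues). $\chi(G)$ is the chromatic number. Fractional chromatic number $\chi_f(G)$: the minimum of $\sum_{J} \sigma_J$ over all maps $\sigma$ from the set of independent sets of $G$ to $\mathbb{R}_{\ge 0}$ such that $\sum_{J \ni v} \sigma_J \ge 1$ for every vertex $v$. Quantum chromatic number $\chi_q(G)$: the smallest $r$ such that for some $d>0$ there are orthogonal projectors $P_{v,k} \in \mathbb{C}^{d\times d}$ ($v \in V$, $k \in [r]$) with $\sum_{k=1}^r P_{v,k} = I_d$ for all $v$ and $P_{v,k}P_{w,k} = O$ for all edges $vw$ and all $k$. Orthogonal rank $\xi(G)$: the smallest $d$ such that there are nonzero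 vectors $x_v \in \mathbb{C}^d$ with $x_v^* x_w = 0$ for every edge $vw$. A $d/r$-representation of $G$ is a family of rank-$r$ orthogonal projectors $P_v \in \mathbb{C}^{d\times d}$, $v \in V(G)$, with $P_vP_w = O$ for every edge $vw$; the projective rank is $\xi_f(G) = \inf\{d/r : G \text{ has a } d/r\text{-representation}\}$. *)

theory Defs
  imports "Jordan_Normal_Form.Char_Poly" "Jordan_Normal_Form.Schur_Decomposition"
          "Jordan_Normal_Form.DL_Rank"
begin

definition simple_graph :: "nat \<Rightarrow> (nat \<Rightarrow> nat \<Rightarrow> bool) \<Rightarrow> bool" where
  "simple_graph n E \<longleftrightarrow> (\<forall>u v. E u v \<longrightarrow> u < n \<and> v < n \<and> u \<noteq> v \<and> E v u)"

definition adj_mat :: "nat \<Rightarrow> (nat \<Rightarrow> nat \<Rightarrow> bool) \<Rightarrow> real mat" where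
  "adj_mat n E = mat n n (\<lambda>(i,j). if E i j then 1 else 0)"

definition pos_energy :: "real \<Rightarrow> nat \<Rightarrow> (nat \<Rightarrow> nat \<Rightarrow> bool) \<Rightarrow> real" where
  "pos_energy p n E = (let q = char_poly (adj_mat n E) in
     (\<Sum>x\<in>{x. x > 0 \<and> poly q x = 0}. real (order x q) * x powr p))"

definition neg_energy :: "real \<Rightarrow> nat \<Rightarrow> (nat \<Rightarrow> nat \<Rightarrow> bool) \<Rightarrow> real" where
  "neg_energy p n E = (let q = char_poly (adj_mat n E) in
     (\<Sum>x\<in>{x. x < 0 \<and> poly q x = 0}. real (order x q) * \<bar>x\<bar> powr p))"

definition chromatic_number :: "nat \<Rightarrow> (nat \<Rightarrow> nat \<Rightarrow> bool) \<Rightarrow> nat" where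
  "chromatic_number n E = (LEAST k. \<exists>c :: nat \<Rightarrow> nat.
      (\<forall>v<n. c v < k) \<and> (\<forall>u<n. \<forall>v<n. E u v \<longrightarrow> c u \<noteq> c v))"

definition independent_sets :: "nat \<Rightarrow> (nat \<Rightarrow> nat \<Rightarrow> bool) \<Rightarrow> nat set set" where
  "independent_sets n E = {J. J \<subseteq> {0..<n} \<and> (\<forall>u\<in>J. \<forall>v\<in>J. \<not> E u v)}"

definition frac_chromatic_number :: "nat \<Rightarrow> (nat \<Rightarrow> nat \<Rightarrow> bool) \<Rightarrow> real" where
  "frac_chromatic_number n E = Inf {(\<Sum>J\<in>independent_sets n E. \<sigma> J) | \<sigma> :: nat set \<Rightarrow> real.
      (\<forall>J\<in>independent_sets n E. \<sigma> J \<ge> 0) \<and>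
      (\<forall>v<n. (\<Sum>J\<in>{J\<in>independent_sets n E. v \<in> J}. \<sigma> J) \<ge> 1)}"

definition orth_projector :: "nat \<Rightarrow> complex mat \<Rightarrow> bool" where
  "orth_projector d P \<longleftrightarrow> P \<in> carrier_mat d d \<and> P * P = P \<and> mat_adjoint P = P"

definition quantum_chromatic_number :: "nat \<Rightarrow> (nat \<Rightarrow> nat \<Rightarrow> bool) \<Rightarrow> nat" where
  "quantum_chromatic_number n E = (LEAST r. \<exists>d > 0. \<exists>P :: nat \<Rightarrow> nat \<Rightarrow> complex mat.
      (\<forall>v<n. \<forall>k<r. orth_projector d (P v k)) \<and>
      (\<forall>v<n. \<forall>i<d. \<forall>j<d. (\<Sum>k\<in>{0..<r}. P v k $$ (i,j)) = (1\<^sub>m d) $$ (i,j)) \<and>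
      (\<forall>u<n. \<forall>v<n. E u v \<longrightarrow> (\<forall>k<r. P u k * P v k = 0\<^sub>m d d)))"

definition orthogonal_rank :: "nat \<Rightarrow> (nat \<Rightarrow> nat \<Rightarrow> bool) \<Rightarrow> nat" where
  "orthogonal_rank n E = (LEAST d. \<exists>x :: nat \<Rightarrow> complex vec.
      (\<forall>v<n. x v \<in> carrier_vec d \<and> x v \<noteq> 0\<^sub>v d) \<and>
      (\<forall>u<n. \<forall>v<n. E u v \<longrightarrow> x v \<bullet>c x u = 0))"

text \<open>The condition sum_k P_{v,k} = I_d is stated entrywise (no matrix sum in the library).\<close>

definition has_representation :: "nat \<Rightarrow> (nat \<Rightarrow> nat \<Rightarrow> bool) \<Rightarrow> nat \<Rightarrow> nat \<Rightarrow> bool" where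
  "has_representation n E d r \<longleftrightarrow> (\<exists>P :: nat \<Rightarrow> complex mat.
      (\<forall>v<n. orth_projector d (P v) \<and> vec_space.rank d (P v) = r) \<and>
      (\<forall>u<n. \<forall>v<n. E u v \<longrightarrow> P u * P v = 0\<^sub>m d d))"

definition projective_rank :: "nat \<Rightarrow> (nat \<Rightarrow> nat \<Rightarrow> bool) \<Rightarrow> real" where
  "projective_rank n E = Inf {real d / real r | d r. r > 0 \<and> has_representation n E d r}"

end

theory Submission
  imports Defs
begin

text \<open>
  Write \<open>A = B - C\<close> with \<open>B\<close> and \<open>C\<close> the positive and negative parts of the adjacency matrix. A
  \<open>d/r\<close>-representation gives a block diagonal projection \<open>P\<close> on \<open>\<complex>\<^sup>n \<otimes> \<complex>\<^sup>d\<close> with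
  \<open>P (A \<otimes> I) P = 0\<close>, that is \<open>P B P = P C P\<close> (dropping the \<open>\<otimes> I\<close>), and
  \<open>tr (f(A) P) = r tr f(A)\<close> for every \<open>f\<close>. Diagonalising \<open>P B P\<close> inside the range of \<open>P\<close> yields
  vectors that are orthogonal for both \<open>B\<close> and \<open>C\<close>, and from these a coupling \<open>\<mu>\<close> of the positive
  eigenvalues \<open>b\<close> with the negative eigenvalues \<open>-c\<close>. Its marginal in \<open>c\<close> is the diagonal of \<open>P\<close>,
  its \<open>c\<close>-weighted marginal in \<open>b\<close> is \<open>b\<close> times the diagonal of \<open>P\<close>, and its \<open>b^p\<close>-moment is at
  most \<open>tr (B^p (I - P))\<close>. Integrating Young's inequality for \<open>b\<close> and \<open>t c\<close>, where
  \<open>t = d/r - 1\<close>, against \<open>\<mu>\<close> bounds one \<open>p\<close>-energy by \<open>t\<close> to the power \<open>\<bar>p - 1\<bar>\<close> times the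
  other; exchanging \<open>A\<close> and \<open>-A\<close> gives the second ratio. For the upper bounds, a colouring is a
  feasible point for each of the three parameters, and each of them yields representations: block
  diagonal sums of the measurements of a quantum colouring, rank one projections onto orthogonal
  vectors, and coordinate projections from a fractional colouring with rounded weights.
\<close>

section \<open>Rank and trace of idempotent matrices\<close>

text \<open>A maximal independent set \<open>S\<close> of columns factors \<open>P\<close> as
  \<open>S C\<close>, where \<open>C\<close> holds the coefficients \<open>c\<close>. Since
  \<open>P\<close> fixes its own columns, \<open>S (C S) = S\<close>, and independence forces
  \<open>C S\<close> to be the identity. Hence \<open>tr P = tr (C S) = card S\<close>.\<close>

lemma idempotent_rank_eq_trace:
  assumes "P \<in> carrier_mat d d" and "P * P = (P :: complex mat)"
  shows "(\<Sum>i<d. P $$ (i,i)) = of_nat (vec_space.rank d P)"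
proof -
  interpret vec_space "TYPE(complex)" d .
  let ?C = "set (cols P)"
  have C: "?C \<subseteq> carrier_vec d" using assms cols_dim by blast
  obtain S where max: "maximal S (\<lambda>T. T \<subseteq> ?C \<and> lin_indpt T)" and fin: "finite S"
    using maximal_exists_superset[of ?C "\<lambda>T. T \<subseteq> ?C \<and> lin_indpt T" "{}"]
    by (auto simp: lin_dep_def)
  have rk: "rank P = card S" using rank_card_indpt[OF assms(1) max] .
  from max have SC: "S \<subseteq> ?C" and li: "lin_indpt S" by (auto simp: maximal_def)
  have Sc: "S \<subseteq> carrier_vec d" using SC C by blast
  have span: "x \<in> span S" if "x \<in> ?C" for x
  proof (rule ccontr)
    assume n: "x \<notin> span S"
    have x: "x \<in> carrier_vec d" using that C by auto
    have "x \<notin> S" using n Sc span_mem by auto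
    then have "lin_indpt (S \<union> {x})" using lin_dep_iff_in_span[OF Sc li x] n by auto
    then have "S \<union> {x} = S"
      using max SC that unfolding maximal_def by blast
    then show False using \<open>x \<notin> S\<close> by blast
  qed
  have "\<exists>a. col P j = lincomb a S" if "j < d" for j
  proof -
    have "col P j \<in> ?C" using that assms(1) by (auto simp: cols_def)
    then have "\<exists>a. a \<in> S \<rightarrow> UNIV \<and> lincomb a S = col P j"
      using finite_in_span[OF fin _ span] Sc by auto
    then show ?thesis by metis
  qed
  then obtain c where c: "\<And>j. j < d \<Longrightarrow> col P j = lincomb (c j) S" by metis
  have Pij: "P $$ (i,j) = (\<Sum>s\<in>S. c j s * s $ i)" if "i < d" "j < d" for i j
  proof -
    have "P $$ (i,j) = col P j $ i" using that assms by auto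
    also have "\<dots> = (\<Sum>s\<in>S. c j s * s $ i)" using c[OF that(2)] lincomb_index[OF that(1) Sc] by simp
    finally show ?thesis .
  qed
  have fix_S: "(\<Sum>j<d. P $$ (i,j) * s $ j) = s $ i" if sS: "s \<in> S" and id: "i < d" for s i
  proof -
    obtain k where k: "k < d" "s = col P k" using subsetD[OF SC sS] assms(1)
      by (auto simp: cols_def)
    have "s $ i = (P * P) $$ (i,k)" using k id assms by simp
    also have "\<dots> = (\<Sum>j<d. P $$ (i,j) * s $ j)"
      using k id assms(1) by (auto simp: scalar_prod_def lessThan_atLeast0 intro!: sum.cong)
    finally show ?thesis by simp
  qed
  have diag: "(\<Sum>j<d. c j s * s $ j) = 1" if s: "s \<in> S" for s
  proof -
    \<comment> \<open>The vector \<open>s\<close> has the coefficients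
      \<open>\<Sum>j<d. c j t * s $ j\<close> because \<open>P\<close> fixes it, and the unit
      coefficients because it lies in \<open>S\<close>. Their difference \<open>a\<close> is a
      linear relation on \<open>S\<close>.\<close>
    define a where "a t = (\<Sum>j<d. c j t * s $ j) - (if t = s then 1 else 0)" for t
    have "lincomb a S = 0\<^sub>v d"
    proof (rule eq_vecI)
      show "dim_vec (lincomb a S) = dim_vec (0\<^sub>v d)" using lincomb_dim[OF fin Sc] by simp
      fix i assume "i < dim_vec (0\<^sub>v d :: complex vec)"
      then have i: "i < d" by simp
      have "lincomb a S $ i = (\<Sum>t\<in>S. a t * t $ i)" using lincomb_index[OF i Sc] .
      also have "\<dots> = (\<Sum>t\<in>S. \<Sum>j<d. c j t * s $ j * t $ i) - (\<Sum>t\<in>S. if t = s then t $ i else 0)"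
        unfolding a_def sum_subtractf[symmetric]
        by (intro sum.cong) (auto simp: algebra_simps sum_distrib_left)
      also have "(\<Sum>t\<in>S. \<Sum>j<d. c j t * s $ j * t $ i) = (\<Sum>j<d. P $$ (i,j) * s $ j)"
        by (subst sum.swap) (auto simp: Pij i sum_distrib_left mult_ac intro!: sum.cong)
      also have "\<dots> = s $ i" using fix_S s i by simp
      also have "(\<Sum>t\<in>S. if t = s then t $ i else 0) = s $ i" using fin s by simp
      finally show "lincomb a S $ i = 0\<^sub>v d $ i" using i by simp
    qed
    then have "a s = 0" using not_lindepD[OF li fin subset_refl, of a] s by (auto simp: class_ring_simps)
    then show ?thesis by (simp add: a_def)
  qed
  have "(\<Sum>i<d. P $$ (i,i)) = (\<Sum>s\<in>S. \<Sum>i<d. c i s * s $ i)"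
    by (subst sum.swap) (auto simp: Pij)
  also have "\<dots> = of_nat (card S)" by (simp add: diag)
  finally show ?thesis using rk by simp
qed

section \<open>The spectral theorem for Hermitian kernels on a finite set\<close>

lemma sum_of_bool:
  fixes f :: "'a \<Rightarrow> 'b::semiring_1"
  assumes "finite Z" "w \<in> Z"
  shows "(\<Sum>a\<in>Z. f a * of_bool (a = w)) = f w" "(\<Sum>a\<in>Z. f a * of_bool (w = a)) = f w"
    "(\<Sum>a\<in>Z. of_bool (a = w) * f a) = f w" "(\<Sum>a\<in>Z. of_bool (w = a) * f a) = f w"
  using assms by (simp_all add: of_bool_def if_distrib if_distribR cong: if_cong)

text \<open>Expansion of two linear combinations paired with a diagonal weight \<open>c\<close>. The
  changes of basis and the norm computations below are instances.\<close>

lemma sum_bilinear: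
  fixes A B :: "'a \<Rightarrow> 'b \<Rightarrow> 'c::comm_semiring_1"
  shows "(\<Sum>x\<in>X. c x * (\<Sum>a\<in>Y. A x a * f a) * (\<Sum>b\<in>Z. B x b * g b))
    = (\<Sum>a\<in>Y. \<Sum>b\<in>Z. f a * g b * (\<Sum>x\<in>X. c x * A x a * B x b))"
proof -
  have "(\<Sum>x\<in>X. c x * (\<Sum>a\<in>Y. A x a * f a) * (\<Sum>b\<in>Z. B x b * g b))
    = (\<Sum>x\<in>X. \<Sum>a\<in>Y. \<Sum>b\<in>Z. f a * g b * (c x * A x a * B x b))"
    by (simp add: sum_distrib_left sum_distrib_right mult_ac)
  also have "\<dots> = (\<Sum>a\<in>Y. \<Sum>x\<in>X. \<Sum>b\<in>Z. f a * g b * (c x * A x a * B x b))"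
    by (rule sum.swap)
  also have "\<dots> = (\<Sum>a\<in>Y. \<Sum>b\<in>Z. \<Sum>x\<in>X. f a * g b * (c x * A x a * B x b))"
    by (intro sum.cong refl sum.swap)
  finally show ?thesis by (simp add: sum_distrib_left)
qed

text \<open>Numbering \<open>Z\<close> gives a matrix whose characteristic polynomial has positive
  degree, hence a complex root. Kernels on an arbitrary finite set are used so that \<open>Z\<close>
  can later be a product of two index sets.\<close>

lemma eigenvector_exists:
  fixes H :: "'a \<Rightarrow> 'a \<Rightarrow> complex"
  assumes "finite Z" "Z \<noteq> {}"
  obtains e v where "\<exists>z\<in>Z. v z \<noteq> 0" "\<And>x. x \<in> Z \<Longrightarrow> (\<Sum>y\<in>Z. H x y * v y) = e * v x"
proof -
  define n where "n = card Z"
  have n: "n > 0" using assms n_def by (simp add: card_gt_0_iff)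
  obtain h where h: "bij_betw h {0..<n} Z" using ex_bij_betw_nat_finite[OF assms(1)] n_def by auto
  define g where "g = inv_into {0..<n} h"
  have gh: "g (h i) = i" if "i < n" for i using h that unfolding g_def
    by (simp add: bij_betw_inv_into_left)
  have g: "g x < n" "h (g x) = x" if "x \<in> Z" for x
    using h that unfolding g_def
    by (metis atLeastLessThan_iff bij_betw_def inv_into_into, metis bij_betw_inv_into_right)
  define M where "M = mat n n (\<lambda>(i,j). H (h i) (h j))"
  have M: "M \<in> carrier_mat n n" by (simp add: M_def)
  have "degree (char_poly M) = n" using degree_monic_char_poly[OF M] by simp
  then have "\<not> constant (poly (char_poly M))" using n by (simp add: constant_degree)
  then obtain e where "poly (char_poly M) e = 0" using fundamental_theorem_of_algebra by blast
  then have "eigenvalue M e" using eigenvalue_root_char_poly[OF M] by simp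
  then obtain u where u: "u \<in> carrier_vec n" "u \<noteq> 0\<^sub>v n" "M *\<^sub>v u = e \<cdot>\<^sub>v u"
    using M unfolding eigenvalue_def eigenvector_def by auto
  show ?thesis
  proof
    have "\<exists>i<n. u $ i \<noteq> 0"
    proof (rule ccontr)
      assume "\<not> ?thesis"
      then have "u = 0\<^sub>v n" using u(1) by (intro eq_vecI) auto
      with u(2) show False ..
    qed
    then obtain i where "i < n" "u $ i \<noteq> 0" by blast
    then show "\<exists>z\<in>Z. u $ g z \<noteq> 0"
      using gh h by (intro bexI[of _ "h i"]) (auto simp: bij_betw_def)
    fix x assume x: "x \<in> Z"
    have "e * u $ g x = (M *\<^sub>v u) $ g x" using u g[OF x] by simp
    also have "\<dots> = (\<Sum>j\<in>{0..<n}. H (h (g x)) (h j) * u $ j)"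
      using g[OF x] u(1) by (simp add: M_def scalar_prod_def)
    also have "\<dots> = (\<Sum>j\<in>{0..<n}. H x (h j) * u $ g (h j))" using g x gh by simp
    also have "\<dots> = (\<Sum>y\<in>Z. H x y * u $ g y)" by (rule sum.reindex_bij_betw[OF h])
    finally show "(\<Sum>y\<in>Z. H x y * u $ g y) = e * u $ g x" by simp
  qed
qed

text \<open>An eigenvector can be scaled to norm one and rotated by a phase; a real nonpositive
  entry at \<open>z\<close> is what the reflection below requires.\<close>

lemma unit_eigenvector_exists:
  fixes H :: "'a \<Rightarrow> 'a \<Rightarrow> complex"
  assumes "finite Z" "z \<in> Z"
  obtains e v t where "(\<Sum>x\<in>Z. v x * cnj (v x)) = 1" "v z = of_real t" "t \<le> 0"
    "\<And>x. x \<in> Z \<Longrightarrow> (\<Sum>y\<in>Z. H x y * v y) = e * v x"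
proof -
  obtain e u where u: "\<exists>x\<in>Z. u x \<noteq> 0" "\<And>x. x \<in> Z \<Longrightarrow> (\<Sum>y\<in>Z. H x y * u y) = e * u x"
    using eigenvector_exists[OF assms(1)] assms(2) by (metis empty_iff)
  define N where "N = (\<Sum>x\<in>Z. (cmod (u x))\<^sup>2)"
  have "N > 0" unfolding N_def using u(1) assms by (auto intro: sum_pos2)
  \<comment> \<open>The phase turning \<open>u z\<close> into minus its modulus; any phase would do
    when that entry is zero.\<close>
  define s where "s = (if u z = 0 then 1 else - cnj (u z) / of_real (cmod (u z)))"
  have s1: "s * cnj s = 1" 
  proof (cases "u z = 0")
    case False
    then show ?thesis
      by (simp add: s_def complex_norm_square[symmetric] mult.commute[of "cnj _"] divide_simps power2_eq_square)
  qed (simp add: s_def)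
  have s2: "s * u z = of_real (- cmod (u z))"
  proof (cases "u z = 0")
    case False
    have "cnj (u z) * u z = of_real ((cmod (u z))\<^sup>2)"
      by (metis complex_norm_square mult.commute)
    then show ?thesis using False by (simp add: s_def power2_eq_square)
  qed (simp add: s_def)
  define c where "c = s / of_real (sqrt N)"
  have cc: "c * cnj c = 1 / of_real N" unfolding c_def using s1 \<open>N > 0\<close>
    by (simp flip: of_real_mult)
  show ?thesis
  proof
    have "(\<Sum>x\<in>Z. c * u x * cnj (c * u x)) = c * cnj c * (\<Sum>x\<in>Z. u x * cnj (u x))"
      by (simp add: sum_distrib_left mult_ac)
    also have "\<dots> = 1" unfolding cc using \<open>N > 0\<close>
      by (simp add: N_def complex_norm_square[symmetric] flip: of_real_power of_real_sum)
    finally show "(\<Sum>x\<in>Z. c * u x * cnj (c * u x)) = 1" .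
    show "c * u z = of_real (- cmod (u z) / sqrt N)" unfolding c_def using s2 by simp
    show "- cmod (u z) / sqrt N \<le> 0" using \<open>N > 0\<close> by simp
    show "(\<Sum>y\<in>Z. H x y * (c * u y)) = e * (c * u x)" if "x \<in> Z" for x
      using u(2)[OF that] by (simp add: mult.left_commute sum_distrib_left[symmetric])
  qed
qed

text \<open>The reflection \<open>I - c w w^*\<close> along \<open>w = v - e_z\<close> exchanges
  \<open>v\<close> and the unit vector \<open>e_z\<close>. The factor \<open>c = 1 / (1 - t)\<close>
  equals \<open>2\<close> over the squared norm of \<open>w\<close> because \<open>v z\<close> is
  real, and \<open>t \<le> 0\<close> keeps the denominator away from zero.\<close>

lemma householder_reflection:
  fixes v :: "'a \<Rightarrow> complex"
  assumes "finite Z" "z \<in> Z" and v: "(\<Sum>x\<in>Z. v x * cnj (v x)) = 1" "v z = of_real t" "t \<le> 0"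
  obtains U where "\<And>x y. cnj (U x y) = U y x" "\<And>x. x \<in> Z \<Longrightarrow> U x z = v x"
    "\<And>x y. x \<in> Z \<Longrightarrow> y \<in> Z \<Longrightarrow> (\<Sum>a\<in>Z. U x a * U a y) = of_bool (x = y)"
proof -
  define c :: complex where "c = 1 / (1 - of_real t)"
  have c: "c * (1 - of_real t) = 1" 
    using v(3) by (simp add: c_def)
  define w where "w x = v x - of_bool (x = z)" for x
  define U where "U x y = of_bool (x = y) - c * w x * cnj (w y)" for x y
  have wz: "w z = of_real t - 1" by (simp add: w_def v)
  have "(\<Sum>x\<in>Z. w x * cnj (w x)) = (\<Sum>x\<in>Z. v x * cnj (v x)) - (\<Sum>x\<in>Z. v x * of_bool (x = z))
      - (\<Sum>x\<in>Z. cnj (v x) * of_bool (x = z)) + (\<Sum>x\<in>Z. 1 * of_bool (x = z))"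
    unfolding sum_subtractf[symmetric] sum.distrib[symmetric]
    by (intro sum.cong) (auto simp: w_def algebra_simps)
  also have "\<dots> = 2 * (1 - of_real t)" using assms(1,2) v by (simp add: sum_of_bool del: sum_mult_of_bool_eq)
  finally have ww: "(\<Sum>x\<in>Z. w x * cnj (w x)) = 2 * (1 - of_real t)" .
  show ?thesis
  proof
    show "cnj (U x y) = U y x" for x y by (auto simp: U_def c_def)
    show "U x z = v x" if "x \<in> Z" for x
    proof -
      have "U x z = of_bool (x = z) + (c * (1 - of_real t)) * w x"
        by (simp add: U_def wz algebra_simps)
      then show ?thesis unfolding c by (simp add: w_def)
    qed
    fix x y assume xy: "x \<in> Z" "y \<in> Z"
    have "(\<Sum>a\<in>Z. U x a * U a y) = (\<Sum>a\<in>Z. of_bool (x = a) * of_bool (a = y))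
       - (\<Sum>a\<in>Z. c * w a * cnj (w y) * of_bool (x = a))
       - (\<Sum>a\<in>Z. c * w x * cnj (w a) * of_bool (a = y))
       + c * w x * cnj (w y) * (c * (\<Sum>a\<in>Z. w a * cnj (w a)))"
      unfolding sum_distrib_left sum_subtractf[symmetric] sum.distrib[symmetric]
      by (intro sum.cong) (auto simp: U_def algebra_simps)
    also have "\<dots> = of_bool (x = y) - c * w x * cnj (w y) - c * w x * cnj (w y)
       + c * w x * cnj (w y) * (2 * (c * (1 - of_real t)))"
      unfolding ww sum_of_bool(2)[OF assms(1) xy(1)] sum_of_bool(4)[OF assms(1) xy(1)]
        sum_of_bool(1)[OF assms(1) xy(2)] by (simp add: mult_ac)
    also have "\<dots> = of_bool (x = y)" unfolding c by simp
    finally show "(\<Sum>a\<in>Z. U x a * U a y) = of_bool (x = y)" .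
  qed
qed

text \<open>Induction on \<open>Z\<close>: a reflection carries an eigenvector to the coordinate
  \<open>z\<close>, which splits off a one-dimensional block, and the induction hypothesis handles
  the block on \<open>S\<close>. Indexing the eigenvectors by \<open>Z\<close> itself avoids a
  second index set.\<close>

theorem hermitian_spectral:
  fixes H :: "'a \<Rightarrow> 'a \<Rightarrow> complex"
  assumes "finite Z" "\<forall>x\<in>Z. \<forall>y\<in>Z. cnj (H x y) = H y x"
  shows "\<exists>y \<kappa>. (\<forall>k\<in>Z. \<forall>l\<in>Z. (\<Sum>x\<in>Z. y k x * cnj (y l x)) = of_bool (k = l)) \<and>
    (\<forall>x\<in>Z. \<forall>z\<in>Z. (\<Sum>k\<in>Z. y k x * cnj (y k z)) = of_bool (x = z)) \<and>
    (\<forall>x\<in>Z. \<forall>z\<in>Z. H x z = (\<Sum>k\<in>Z. of_real (\<kappa> k) * y k x * cnj (y k z)))"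
  using assms
proof (induction Z arbitrary: H rule: finite_induct)
  case empty
  then show ?case by simp
next
  case (insert z S)
  define Z where Z: "Z = insert z S"
  have fin: "finite Z" and zZ: "z \<in> Z" using insert by (auto simp: Z)
  note herm = insert.prems[folded Z, rule_format]
  obtain e v t where v: "(\<Sum>x\<in>Z. v x * cnj (v x)) = 1" "v z = of_real t" "t \<le> 0"
    and ev: "\<And>x. x \<in> Z \<Longrightarrow> (\<Sum>y\<in>Z. H x y * v y) = e * v x"
    by (rule unit_eigenvector_exists[OF fin zZ, where H = H]) (rule that)
  obtain U where cU: "\<And>x y. cnj (U x y) = U y x" and Uz: "\<And>x. x \<in> Z \<Longrightarrow> U x z = v x"
    and UU: "\<And>x y. x \<in> Z \<Longrightarrow> y \<in> Z \<Longrightarrow> (\<Sum>a\<in>Z. U x a * U a y) = of_bool (x = y)"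
    by (rule householder_reflection[OF fin zZ v]) (rule that)
  \<comment> \<open>\<open>G\<close> is \<open>U H U\<close>. Column \<open>z\<close> of
    \<open>U\<close> is the eigenvector \<open>v\<close>, so in \<open>G\<close> both the row and
    the column at \<open>z\<close> vanish off the diagonal.\<close>
  define G where "G x y = (\<Sum>a\<in>Z. U x a * (\<Sum>b\<in>Z. H a b * U b y))" for x y
  have cG: "cnj (G x y) = G y x" for x y
  proof -
    have "cnj (G x y) = (\<Sum>a\<in>Z. \<Sum>b\<in>Z. U y b * (H b a * U a x))"
      using herm by (auto simp: G_def cU sum_distrib_left mult_ac intro!: sum.cong)
    also have "\<dots> = G y x" by (subst sum.swap) (simp add: G_def sum_distrib_left)
    finally show ?thesis .
  qed
  have Gz: "G x z = e * of_bool (x = z)" if "x \<in> Z" for x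
  proof -
    have "G x z = (\<Sum>a\<in>Z. U x a * (e * U a z))"
      unfolding G_def using ev by (intro sum.cong refl) (simp add: Uz zZ)
    also have "\<dots> = e * of_bool (x = z)"
      using UU[OF that zZ] by (simp add: mult.left_commute sum_distrib_left[symmetric])
    finally show ?thesis .
  qed
  have e: "cnj e = e" using cG[of z z] Gz[OF zZ] by simp
  have zG: "G z x = e * of_bool (x = z)" if "x \<in> Z" for x
    using cG[of x z] Gz[OF that] e by auto
  \<comment> \<open>\<open>U\<close> is its own inverse, so \<open>G = U H U\<close> turns back into
    \<open>H = U G U\<close>.\<close>
  have HG: "H x y = (\<Sum>a\<in>Z. \<Sum>b\<in>Z. U x a * U b y * G a b)" if xy: "x \<in> Z" "y \<in> Z" for x y
  proof -
    have "(\<Sum>a\<in>Z. \<Sum>b\<in>Z. U x a * U b y * G a b)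
      = (\<Sum>a\<in>Z. \<Sum>b\<in>Z. \<Sum>c\<in>Z. \<Sum>d\<in>Z. (U x a * U a c) * (U d b * U b y) * H c d)"
      by (simp add: G_def sum_distrib_left sum_distrib_right mult_ac)
    also have "\<dots> = (\<Sum>a\<in>Z. \<Sum>c\<in>Z. \<Sum>b\<in>Z. \<Sum>d\<in>Z. (U x a * U a c) * (U d b * U b y) * H c d)"
      by (intro sum.cong refl sum.swap)
    also have "\<dots> = (\<Sum>c\<in>Z. \<Sum>a\<in>Z. \<Sum>b\<in>Z. \<Sum>d\<in>Z. (U x a * U a c) * (U d b * U b y) * H c d)"
      by (rule sum.swap)
    also have "\<dots> = (\<Sum>c\<in>Z. \<Sum>a\<in>Z. \<Sum>d\<in>Z. \<Sum>b\<in>Z. (U x a * U a c) * (U d b * U b y) * H c d)"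
      by (intro sum.cong refl sum.swap)
    also have "\<dots> = (\<Sum>c\<in>Z. \<Sum>d\<in>Z. \<Sum>a\<in>Z. \<Sum>b\<in>Z. (U x a * U a c) * (U d b * U b y) * H c d)"
      by (intro sum.cong refl sum.swap)
    also have "\<dots> = (\<Sum>c\<in>Z. \<Sum>d\<in>Z. (\<Sum>a\<in>Z. U x a * U a c) * (\<Sum>b\<in>Z. U d b * U b y) * H c d)"
      unfolding sum_product unfolding sum_distrib_right ..
    also have "\<dots> = (\<Sum>c\<in>Z. \<Sum>d\<in>Z. of_bool (x = c) * (of_bool (d = y) * H c d))"
      using UU xy by (intro sum.cong refl) simp
    also have "\<dots> = H x y"
      unfolding sum_distrib_left[symmetric] sum_of_bool(4)[OF fin xy(1)] sum_of_bool(3)[OF fin xy(2)] ..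
    finally show ?thesis by simp
  qed
  have "\<forall>x\<in>S. \<forall>y\<in>S. cnj (G x y) = G y x" using cG by simp
  note IH = insert.IH[OF this]
  obtain y' \<kappa>' where
    "\<forall>k\<in>S. \<forall>l\<in>S. (\<Sum>x\<in>S. y' k x * cnj (y' l x)) = of_bool (k = l)"
    "\<forall>x\<in>S. \<forall>w\<in>S. (\<Sum>k\<in>S. y' k x * cnj (y' k w)) = of_bool (x = w)"
    "\<forall>x\<in>S. \<forall>w\<in>S. G x w = (\<Sum>k\<in>S. of_real (\<kappa>' k) * y' k x * cnj (y' k w))"
    using IH by (elim exE conjE) (rule that)
  note IH = this[rule_format]
  \<comment> \<open>An eigenbasis of \<open>G\<close>: the unit vector at \<open>z\<close> together
    with the vectors on \<open>S\<close> extended by zero. Applying \<open>U\<close> to it then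
    gives the eigenbasis \<open>y\<close> of \<open>H\<close>.\<close>
  define Y where "Y k x = (if k = z \<or> x = z then of_bool (k = x) else y' k x)" for k x
  define \<kappa> where "\<kappa> k = (if k = z then Re e else \<kappa>' k)" for k
  have Re_e: "of_real (Re e) = e" using e by (simp add: complex_eq_iff)
  have neq: "x \<noteq> z" "z \<noteq> x" if "x \<in> S" for x using that insert.hyps by auto
  have Y1: "(\<Sum>x\<in>Z. Y k x * cnj (Y l x)) = of_bool (k = l)" if "k \<in> Z" "l \<in> Z" for k l
    using that insert.hyps IH(1)[of k l] neq by (auto simp: Z Y_def cong: sum.cong)
  have Y2: "(\<Sum>k\<in>Z. Y k x * cnj (Y k w)) = of_bool (x = w)" if "x \<in> Z" "w \<in> Z" for x w
    using that insert.hyps IH(2)[of x w] neq by (auto simp: Z Y_def cong: sum.cong)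
  have Y3: "G x w = (\<Sum>k\<in>Z. of_real (\<kappa> k) * Y k x * cnj (Y k w))" if "x \<in> Z" "w \<in> Z" for x w
    using that insert.hyps IH(3)[of x w] neq Gz[of x] zG[of w]
    by (auto simp: Z Y_def \<kappa>_def Re_e cong: sum.cong)
  define y where "y k x = (\<Sum>a\<in>Z. U x a * Y k a)" for k x
  have cy: "cnj (y k x) = (\<Sum>a\<in>Z. U a x * cnj (Y k a))" for k x
    by (simp add: y_def cU)
  have "(\<Sum>x\<in>Z. y k x * cnj (y l x)) = of_bool (k = l)" if kl: "k \<in> Z" "l \<in> Z" for k l
  proof -
    have "(\<Sum>x\<in>Z. y k x * cnj (y l x))
      = (\<Sum>x\<in>Z. 1 * (\<Sum>a\<in>Z. U x a * Y k a) * (\<Sum>b\<in>Z. U b x * cnj (Y l b)))"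
      unfolding cy by (simp add: y_def)
    also have "\<dots> = (\<Sum>a\<in>Z. \<Sum>b\<in>Z. Y k a * cnj (Y l b) * (\<Sum>x\<in>Z. 1 * U x a * U b x))"
      by (rule sum_bilinear)
    also have "\<dots> = (\<Sum>a\<in>Z. \<Sum>b\<in>Z. Y k a * cnj (Y l b) * of_bool (b = a))"
    proof (intro sum.cong refl)
      fix a b assume "a \<in> Z" "b \<in> Z"
      then have "(\<Sum>x\<in>Z. 1 * U x a * U b x) = of_bool (b = a)"
        using UU[of b a] by (simp add: mult.commute)
      then show "Y k a * cnj (Y l b) * (\<Sum>x\<in>Z. 1 * U x a * U b x) = Y k a * cnj (Y l b) * of_bool (b = a)"
        by simp
    qed
    also have "\<dots> = (\<Sum>a\<in>Z. Y k a * cnj (Y l a))"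
      by (rule sum.cong[OF refl], rule sum_of_bool(1)[OF fin])
    finally show ?thesis using Y1[OF kl] by simp
  qed
  \<comment> \<open>Arbitrary weights \<open>c\<close> cover both remaining claims: the constant
    \<open>1\<close> gives completeness and \<open>\<kappa>\<close> gives the decomposition of
    \<open>H\<close>.\<close>
  moreover have "(\<Sum>k\<in>Z. of_real (c k) * y k x * cnj (y k w))
      = (\<Sum>a\<in>Z. \<Sum>b\<in>Z. U x a * U b w * (\<Sum>k\<in>Z. of_real (c k) * Y k a * cnj (Y k b)))"
    for x w and c :: "'a \<Rightarrow> real"
    unfolding cy unfolding y_def
    using sum_bilinear[of "\<lambda>k. of_real (c k)" Y "U x" Z "\<lambda>k b. cnj (Y k b)" "\<lambda>b. U b w" Z Z]
    by (simp only: mult.commute[of "Y _ _" "U _ _"] mult.commute[of "cnj (Y _ _)" "U _ _"])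
  note y_prod = this
  have "(\<Sum>k\<in>Z. y k x * cnj (y k w)) = of_bool (x = w)" if xw: "x \<in> Z" "w \<in> Z" for x w
  proof -
    have "(\<Sum>k\<in>Z. y k x * cnj (y k w)) = (\<Sum>a\<in>Z. \<Sum>b\<in>Z. U x a * U b w * of_bool (a = b))"
      using y_prod[of "\<lambda>_. 1" x w] Y2 by simp
    also have "\<dots> = (\<Sum>a\<in>Z. U x a * U a w)"
      by (rule sum.cong[OF refl], rule sum_of_bool(2)[OF fin])
    finally show ?thesis using UU[OF xw] by simp
  qed
  moreover have "H x w = (\<Sum>k\<in>Z. of_real (\<kappa> k) * y k x * cnj (y k w))" if xw: "x \<in> Z" "w \<in> Z" for x w
    unfolding y_prod HG[OF xw] using Y3 by (intro sum.cong refl) simp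
  ultimately show ?case unfolding Z[symmetric] by (intro exI[of _ y] exI[of _ \<kappa>]) blast
qed

section \<open>Coupling the positive and the negative spectrum\<close>

text \<open>Orthogonality leaves only the diagonal terms of the expanded square. The weights
  \<open>w\<close> and \<open>g\<close> are free, so that the plain inner product and the one
  weighted by the negative part of the spectrum are both covered.\<close>

lemma weighted_parseval:
  fixes a :: "'k \<Rightarrow> complex" and w :: "'i \<Rightarrow> real" and g :: "'k \<Rightarrow> real"
  assumes "finite K"
    and orth: "\<And>k l. k \<in> K \<Longrightarrow> l \<in> K \<Longrightarrow>
      (\<Sum>i\<in>I. of_real (w i) * f k i * cnj (f l i)) = of_real (g k) * of_bool (k = l)"
  shows "(\<Sum>i\<in>I. w i * (cmod (\<Sum>k\<in>K. a k * f k i))\<^sup>2) = (\<Sum>k\<in>K. g k * (cmod (a k))\<^sup>2)"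
proof -
  have "complex_of_real (\<Sum>i\<in>I. w i * (cmod (\<Sum>k\<in>K. a k * f k i))\<^sup>2)
    = (\<Sum>i\<in>I. of_real (w i) * (\<Sum>k\<in>K. f k i * a k) * (\<Sum>l\<in>K. cnj (f l i) * cnj (a l)))"
    by (simp add: complex_norm_square mult_ac del: of_real_power)
  also have "\<dots> = (\<Sum>k\<in>K. \<Sum>l\<in>K. a k * cnj (a l) * (\<Sum>i\<in>I. of_real (w i) * f k i * cnj (f l i)))"
    by (rule sum_bilinear)
  also have "\<dots> = (\<Sum>k\<in>K. \<Sum>l\<in>K. a k * cnj (a l) * of_real (g k) * of_bool (k = l))"
    using orth by (intro sum.cong refl) (simp add: mult.assoc)
  also have "\<dots> = (\<Sum>k\<in>K. a k * cnj (a k) * of_real (g k))"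
    by (rule sum.cong[OF refl], rule sum_of_bool(2)[OF assms(1)])
  also have "\<dots> = complex_of_real (\<Sum>k\<in>K. g k * (cmod (a k))\<^sup>2)"
    by (simp add: complex_norm_square mult_ac del: of_real_power)
  finally show ?thesis using of_real_eq_iff by blast
qed

text \<open>\<open>F\<close> is the orthogonal projection of the unit vector at \<open>i\<close>
  onto the span of the \<open>u k\<close>. Its squared norm and its entry at \<open>i\<close> are
  both \<open>s\<close>, so \<open>s\<^sup>2 \<le> s\<close>.\<close>

lemma bessel_coordinate:
  fixes u :: "'k \<Rightarrow> 'i \<Rightarrow> complex"
  assumes "finite K" "finite I" "i \<in> I"
    and orth: "\<And>k l. k \<in> K \<Longrightarrow> l \<in> K \<Longrightarrow> (\<Sum>i\<in>I. u k i * cnj (u l i)) = of_bool (k = l)"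
  shows "(\<Sum>k\<in>K. (cmod (u k i))\<^sup>2) \<le> 1"
proof -
  define s where "s = (\<Sum>k\<in>K. (cmod (u k i))\<^sup>2)"
  have s0: "s \<ge> 0" unfolding s_def by (intro sum_nonneg) simp
  define F where "F j = (\<Sum>k\<in>K. cnj (u k i) * u k j)" for j
  have "F i = of_real s"
    by (simp add: F_def s_def complex_norm_square mult.commute del: of_real_power)
  then have "s\<^sup>2 = (cmod (F i))\<^sup>2" by simp
  also have "\<dots> \<le> (\<Sum>j\<in>I. 1 * (cmod (F j))\<^sup>2)"
    using member_le_sum[of i I "\<lambda>j. 1 * (cmod (F j))\<^sup>2"] assms(2,3) by simp
  also have "\<dots> = (\<Sum>k\<in>K. 1 * (cmod (cnj (u k i)))\<^sup>2)"
    unfolding F_def using orth by (intro weighted_parseval[OF assms(1)]) simp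
  also have "\<dots> = s" by (simp add: s_def)
  finally have "s * s \<le> s * 1" by (simp add: power2_eq_square)
  then show ?thesis using s0 unfolding s_def[symmetric] by (cases "s = 0") auto
qed

text \<open>For \<open>p \<ge> 0\<close> the power is monotone, so
  \<open>b powr p - c powr p\<close> and \<open>b - c\<close> never have opposite signs; dividing
  their product by \<open>b * c\<close> gives the claim.\<close>

lemma rearrangement_powr:
  fixes b c p :: real
  assumes "b > 0" "c > 0" "p \<ge> 0"
  shows "b powr (p - 1) + c powr (p - 1) \<le> b powr p / c + c powr p / b"
proof -
  have "(b powr p - c powr p) * (b - c) \<ge> 0"
  proof (cases "c \<le> b")
    case True
    then have "c powr p \<le> b powr p" using assms by (intro powr_mono2) auto
    then show ?thesis using True by simp
  next
    case False
    then have "b powr p \<le> c powr p" using assms by (intro powr_mono2) auto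
    then show ?thesis using False by (intro mult_nonpos_nonpos) auto
  qed
  then have "b powr p * c + c powr p * b \<le> b powr p * b + c powr p * c"
    by (simp add: algebra_simps)
  moreover have "b powr (p - 1) = b powr p / b" "c powr (p - 1) = c powr p / c"
    using assms by (simp_all add: powr_diff)
  moreover have "B / b + C / c \<le> B / c + C / b" if "B * c + C * b \<le> B * b + C * c" for B C
  proof -
    have "B / c + C / b - (B / b + C / c) = (B * b + C * c - (B * c + C * b)) / (b * c)"
      using assms by (simp add: field_simps)
    also have "\<dots> \<ge> 0" using that assms by simp
    finally show ?thesis by simp
  qed
  ultimately show ?thesis by simp
qed

text \<open>The coupling is \<open>(cmod (M i j))\<^sup>2\<close>. Both marginals are Parseval
  identities, for the orthonormal \<open>u k\<close> and for \<open>neg\<close>. For the moment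
  bound, Bessel limits each row of squared moduli of \<open>M\<close> to total mass
  \<open>1\<close>; what the row spends on positive indices is expressed through \<open>L\<close>
  and bounded below, after summation, by the rearrangement inequality.\<close>

lemma coupling_exists:
  fixes x :: "'k \<Rightarrow> 'z \<Rightarrow> complex" and ev :: "'z \<Rightarrow> real"
  assumes finK: "finite K" and finZ: "finite Z" and \<kappa>: "\<And>k. k \<in> K \<Longrightarrow> \<kappa> k > 0"
    and orth: "\<And>k l. k \<in> K \<Longrightarrow> l \<in> K \<Longrightarrow> (\<Sum>z\<in>Z. x k z * cnj (x l z)) = of_bool (k = l)"
    and pos: "\<And>k l. k \<in> K \<Longrightarrow> l \<in> K \<Longrightarrow>
      (\<Sum>i | i \<in> Z \<and> ev i > 0. of_real (ev i) * x k i * cnj (x l i)) = of_real (\<kappa> k) * of_bool (k = l)"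
    and neg: "\<And>k l. k \<in> K \<Longrightarrow> l \<in> K \<Longrightarrow>
      (\<Sum>j | j \<in> Z \<and> ev j < 0. of_real \<bar>ev j\<bar> * x k j * cnj (x l j)) = of_real (\<kappa> k) * of_bool (k = l)"
  defines "\<rho> z \<equiv> (\<Sum>k\<in>K. (cmod (x k z))\<^sup>2)"
  shows "\<exists>\<mu>. (\<forall>i j. \<mu> i j \<ge> 0) \<and>
    (\<forall>j\<in>Z. (\<Sum>i | i \<in> Z \<and> ev i > 0. \<mu> i j) = \<rho> j) \<and>
    (\<forall>i\<in>Z. ev i > 0 \<longrightarrow> (\<Sum>j | j \<in> Z \<and> ev j < 0. \<bar>ev j\<bar> * \<mu> i j) = ev i * \<rho> i) \<and>
    (\<forall>p\<ge>0. (\<Sum>i | i \<in> Z \<and> ev i > 0. ev i powr p * (\<Sum>j | j \<in> Z \<and> ev j < 0. \<mu> i j))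
      \<le> (\<Sum>i | i \<in> Z \<and> ev i > 0. ev i powr p * (1 - \<rho> i)))"
proof -
  define X where "X = {i. i \<in> Z \<and> ev i > 0}"
  define W where "W = {j. j \<in> Z \<and> ev j < 0}"
  have fin: "finite X" "finite W" and sub: "X \<subseteq> Z" "W \<subseteq> Z" and disj: "X \<inter> W = {}"
    using finZ by (auto simp: X_def W_def)
  have lX: "ev i > 0" if "i \<in> X" for i using that by (simp add: X_def)
  note pos = pos[folded X_def] and neg = neg[folded W_def]
  \<comment> \<open>Up to normalisation, \<open>u k\<close> is the square root of the positive part
    applied to \<open>x k\<close>; by \<open>pos\<close> these vectors are orthonormal.\<close>
  define u where "u k i = of_real (sqrt (ev i / \<kappa> k)) * x k i" for k i
  have uu: "(\<Sum>i\<in>X. u k i * cnj (u l i)) = of_bool (k = l)" if "k \<in> K" "l \<in> K" for k l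
  proof -
    have "(\<Sum>i\<in>X. u k i * cnj (u l i))
      = (\<Sum>i\<in>X. of_real (1 / (sqrt (\<kappa> k) * sqrt (\<kappa> l))) * (of_real (ev i) * x k i * cnj (x l i)))"
    proof (rule sum.cong[OF refl])
      fix i assume "i \<in> X"
      then have "of_real (sqrt (ev i)) * of_real (sqrt (ev i)) = (of_real (ev i) :: complex)"
        using lX[of i] unfolding of_real_mult[symmetric] by simp
      then show "u k i * cnj (u l i) = of_real (1 / (sqrt (\<kappa> k) * sqrt (\<kappa> l))) * (of_real (ev i) * x k i * cnj (x l i))"
        by (simp add: u_def real_sqrt_divide mult_ac)
    qed
    also have "\<dots> = of_real (1 / (sqrt (\<kappa> k) * sqrt (\<kappa> l))) * (of_real (\<kappa> k) * of_bool (k = l))"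
      unfolding sum_distrib_left[symmetric] using pos[OF that] by simp
    also have "\<dots> = of_bool (k = l)"
    proof (cases "k = l")
      case True
      have "1 / (sqrt (\<kappa> k) * sqrt (\<kappa> k)) * \<kappa> k = 1" using \<kappa>[OF that(1)] by simp
      then have "complex_of_real (1 / (sqrt (\<kappa> k) * sqrt (\<kappa> k))) * of_real (\<kappa> k) = 1"
        by (metis of_real_1 of_real_mult)
      then show ?thesis using True by simp
    qed simp
    finally show ?thesis .
  qed
  have x_u: "x k i = of_real (sqrt (\<kappa> k) / sqrt (ev i)) * u k i" if "k \<in> K" "i \<in> X" for k i
  proof -
    have "sqrt (\<kappa> k) / sqrt (ev i) * sqrt (ev i / \<kappa> k) = 1"
      using \<kappa>[OF that(1)] lX[OF that(2)] by (simp add: real_sqrt_divide)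
    then have "complex_of_real (sqrt (\<kappa> k) / sqrt (ev i)) * of_real (sqrt (ev i / \<kappa> k)) = 1"
      by (metis of_real_1 of_real_mult)
    then show ?thesis unfolding u_def mult.assoc[symmetric] by simp
  qed
  have u_norm: "\<kappa> k * (cmod (u k i))\<^sup>2 = ev i * (cmod (x k i))\<^sup>2" if "k \<in> K" "i \<in> X" for k i
    using \<kappa>[OF that(1)] lX[OF that(2)] by (simp add: u_def norm_mult power_mult_distrib)
  have u_sum: "(\<Sum>k\<in>K. \<kappa> k * (cmod (u k i))\<^sup>2) = ev i * \<rho> i" if "i \<in> X" for i
    using u_norm that by (simp add: \<rho>_def sum_distrib_left)
  define M where "M i z = (\<Sum>k\<in>K. cnj (u k i) * x k z)" for i z
  \<comment> \<open>With \<open>x k\<close> spanning the range of a projection \<open>P\<close> and \<open>B\<close> the positive part, \<open>L\<close> is the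
    (conjugate) square root of \<open>B\<^sup>1\<^sup>/\<^sup>2 P B\<^sup>1\<^sup>/\<^sup>2\<close> and \<open>M\<close> is \<open>P B\<^sup>1\<^sup>/\<^sup>2 L\<^sup>-\<^sup>1\<close>.\<close>
  define L where "L i j = (\<Sum>k\<in>K. cnj (u k i) * (of_real (sqrt (\<kappa> k)) * u k j))" for i j
  have L_sym: "cmod (L i j) = cmod (L j i)" for i j
  proof -
    have "cnj (L i j) = L j i" by (simp add: L_def mult_ac)
    then show ?thesis by (metis complex_mod_cnj)
  qed
  have L_sum: "(\<Sum>j\<in>X. (cmod (L i j))\<^sup>2) = ev i * \<rho> i" if "i \<in> X" for i
  proof -
    have "(\<Sum>j\<in>X. 1 * (cmod (L i j))\<^sup>2) = (\<Sum>k\<in>K. \<kappa> k * (cmod (cnj (u k i)))\<^sup>2)"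
      unfolding L_def
    proof (rule weighted_parseval[OF finK])
      fix k l assume kl: "k \<in> K" "l \<in> K"
      have "(\<Sum>j\<in>X. of_real 1 * (of_real (sqrt (\<kappa> k)) * u k j) * cnj (of_real (sqrt (\<kappa> l)) * u l j))
        = of_real (sqrt (\<kappa> k) * sqrt (\<kappa> l)) * (\<Sum>j\<in>X. u k j * cnj (u l j))"
        by (simp add: sum_distrib_left mult_ac)
      also have "\<dots> = of_real (\<kappa> k) * of_bool (k = l)"
        unfolding uu[OF kl] using \<kappa>[OF kl(1)]
        by (cases "k = l") (simp_all flip: of_real_mult)
      finally show "(\<Sum>j\<in>X. of_real 1 * (of_real (sqrt (\<kappa> k)) * u k j) * cnj (of_real (sqrt (\<kappa> l)) * u l j))
        = of_real (\<kappa> k) * of_bool (k = l)" .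
    qed
    then show ?thesis using u_sum[OF that] by simp
  qed
  have M_L: "(cmod (M i j))\<^sup>2 = (cmod (L i j))\<^sup>2 / ev j" if "j \<in> X" for i j
  proof -
    have "M i j = of_real (1 / sqrt (ev j)) * L i j"
      unfolding M_def L_def sum_distrib_left
      by (intro sum.cong refl) (simp add: x_u[OF _ that] mult_ac)
    then show ?thesis using lX[OF that] by (simp add: norm_divide power_divide)
  qed
  have M_W: "(\<Sum>j\<in>W. (cmod (M i j))\<^sup>2) \<le> 1 - (\<Sum>j\<in>X. (cmod (L i j))\<^sup>2 / ev j)" if "i \<in> X" for i
  proof -
    have "(\<Sum>j\<in>X. (cmod (M i j))\<^sup>2) + (\<Sum>j\<in>W. (cmod (M i j))\<^sup>2) = (\<Sum>j\<in>X \<union> W. (cmod (M i j))\<^sup>2)"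
      using fin disj by (simp add: sum.union_disjoint)
    also have "\<dots> \<le> (\<Sum>z\<in>Z. 1 * (cmod (M i z))\<^sup>2)"
      using finZ sub by (auto intro!: sum_mono2)
    also have "\<dots> = (\<Sum>k\<in>K. 1 * (cmod (cnj (u k i)))\<^sup>2)"
      unfolding M_def by (rule weighted_parseval[OF finK]) (simp add: orth)
    also have "\<dots> \<le> 1" using bessel_coordinate[OF finK fin(1) that uu] by simp
    finally show ?thesis using M_L by simp
  qed
  have 3: "(\<Sum>i\<in>X. ev i powr p * (\<Sum>j\<in>W. (cmod (M i j))\<^sup>2)) \<le> (\<Sum>i\<in>X. ev i powr p * (1 - \<rho> i))"
    if "p \<ge> 0" for p
  proof -
    let ?s = "\<lambda>f. \<Sum>i\<in>X. \<Sum>j\<in>X. f i j * (cmod (L i j))\<^sup>2"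
    \<comment> \<open>The moduli of \<open>L\<close> are symmetric, so a double sum may be averaged
      with its transpose. This produces the symmetric expressions that
      \<open>rearrangement_powr\<close> compares.\<close>
    have swap: "?s f = ?s (\<lambda>i j. f j i)" for f by (subst sum.swap) (simp add: L_sym)
    have "2 * ?s (\<lambda>i j. ev i powr (p - 1)) = ?s (\<lambda>i j. ev i powr (p - 1) + ev j powr (p - 1))"
      using swap[of "\<lambda>i j. ev i powr (p - 1)"] by (simp add: distrib_right sum.distrib)
    also have "\<dots> \<le> ?s (\<lambda>i j. ev i powr p / ev j + ev j powr p / ev i)"
      using rearrangement_powr lX that by (intro sum_mono mult_right_mono) auto
    also have "\<dots> = 2 * ?s (\<lambda>i j. ev i powr p / ev j)"
      using swap[of "\<lambda>i j. ev i powr p / ev j"] by (simp add: distrib_right sum.distrib)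
    finally have *: "?s (\<lambda>i j. ev i powr (p - 1)) \<le> ?s (\<lambda>i j. ev i powr p / ev j)" by simp
    have **: "?s (\<lambda>i j. ev i powr (p - 1)) = (\<Sum>i\<in>X. ev i powr p * \<rho> i)"
    proof (rule sum.cong[OF refl])
      fix i assume i: "i \<in> X"
      then show "(\<Sum>j\<in>X. ev i powr (p - 1) * (cmod (L i j))\<^sup>2) = ev i powr p * \<rho> i"
        unfolding sum_distrib_left[symmetric] L_sum[OF i] using lX[OF i] by (simp add: powr_diff)
    qed
    have "(\<Sum>i\<in>X. ev i powr p * (\<Sum>j\<in>W. (cmod (M i j))\<^sup>2))
      \<le> (\<Sum>i\<in>X. ev i powr p * (1 - (\<Sum>j\<in>X. (cmod (L i j))\<^sup>2 / ev j)))"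
      using M_W by (intro sum_mono mult_left_mono) auto
    also have "\<dots> = (\<Sum>i\<in>X. ev i powr p) - ?s (\<lambda>i j. ev i powr p / ev j)"
      by (simp add: right_diff_distrib sum_subtractf sum_distrib_left)
    also have "\<dots> \<le> (\<Sum>i\<in>X. ev i powr p) - (\<Sum>i\<in>X. ev i powr p * \<rho> i)" using * ** by simp
    finally show ?thesis by (simp add: right_diff_distrib sum_subtractf)
  qed
  have 1: "(\<Sum>i\<in>X. (cmod (M i j))\<^sup>2) = \<rho> j" for j
  proof -
    have "(\<Sum>i\<in>X. 1 * (cmod (\<Sum>k\<in>K. x k j * cnj (u k i)))\<^sup>2) = (\<Sum>k\<in>K. 1 * (cmod (x k j))\<^sup>2)"
    proof (rule weighted_parseval[OF finK])
      fix k l assume "k \<in> K" "l \<in> K"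
      then show "(\<Sum>i\<in>X. of_real 1 * cnj (u k i) * cnj (cnj (u l i))) = of_real 1 * of_bool (k = l)"
        using uu[of l k] by (auto simp: mult.commute)
    qed
    then show ?thesis by (simp add: M_def \<rho>_def mult.commute)
  qed
  have 2: "(\<Sum>j\<in>W. \<bar>ev j\<bar> * (cmod (M i j))\<^sup>2) = ev i * \<rho> i" if "i \<in> X" for i
  proof -
    have "(\<Sum>j\<in>W. \<bar>ev j\<bar> * (cmod (M i j))\<^sup>2) = (\<Sum>k\<in>K. \<kappa> k * (cmod (cnj (u k i)))\<^sup>2)"
      unfolding M_def by (rule weighted_parseval[OF finK neg])
    then show ?thesis using u_sum[OF that] by simp
  qed
  show ?thesis unfolding X_def[symmetric] W_def[symmetric]
    using 1 2 3 by (intro exI[of _ "\<lambda>i j. (cmod (M i j))\<^sup>2"]) (auto simp: X_def)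
qed

text \<open>Let \<open>B\<close> and \<open>C\<close> be the positive and negative parts of the
  diagonal \<open>ev\<close>. The hypothesis \<open>iso\<close> says \<open>P B P = P C P\<close>,
  so an eigenbasis of this one operator is orthogonal for both forms. Its vectors with positive
  eigenvalue lie in the range of \<open>P\<close> and are fed to
  \<open>coupling_exists\<close>.\<close>

lemma projection_coupling:
  fixes P :: "'z \<Rightarrow> 'z \<Rightarrow> complex" and ev :: "'z \<Rightarrow> real"
  assumes finZ: "finite Z"
    and herm: "\<forall>x\<in>Z. \<forall>z\<in>Z. cnj (P x z) = P z x"
    and idem: "\<forall>x\<in>Z. \<forall>z\<in>Z. (\<Sum>y\<in>Z. P x y * P y z) = P x z"
    and iso: "\<forall>x\<in>Z. \<forall>z\<in>Z. (\<Sum>y\<in>Z. of_real (ev y) * P x y * P y z) = 0"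
  shows "\<exists>\<mu>. (\<forall>i j. \<mu> i j \<ge> 0) \<and>
    (\<forall>j\<in>Z. ev j < 0 \<longrightarrow> (\<Sum>i | i \<in> Z \<and> ev i > 0. \<mu> i j) = Re (P j j)) \<and>
    (\<forall>i\<in>Z. ev i > 0 \<longrightarrow> (\<Sum>j | j \<in> Z \<and> ev j < 0. \<bar>ev j\<bar> * \<mu> i j) = ev i * Re (P i i)) \<and>
    (\<forall>p\<ge>0. (\<Sum>i | i \<in> Z \<and> ev i > 0. ev i powr p * (\<Sum>j | j \<in> Z \<and> ev j < 0. \<mu> i j))
      \<le> (\<Sum>i | i \<in> Z \<and> ev i > 0. ev i powr p * (1 - Re (P i i))))"
proof -
  note herm = herm[rule_format] and idem = idem[rule_format] and iso = iso[rule_format]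
  define X where "X = {i. i \<in> Z \<and> ev i > 0}"
  define W where "W = {j. j \<in> Z \<and> ev j < 0}"
  have fin: "finite X" "finite W" and sub: "X \<subseteq> Z" "W \<subseteq> Z" and disj: "X \<inter> W = {}"
    using finZ by (auto simp: X_def W_def)
  \<comment> \<open>\<open>H\<close> is \<open>P B P\<close>.\<close>
  define H where "H x z = (\<Sum>i\<in>X. of_real (ev i) * P x i * P i z)" for x z
  have H_herm: "\<forall>x\<in>Z. \<forall>z\<in>Z. cnj (H x z) = H z x"
    unfolding H_def cnj_sum using sub herm by (intro ballI sum.cong refl) (auto simp: mult_ac)
  obtain y \<kappa> where
    "\<forall>k\<in>Z. \<forall>l\<in>Z. (\<Sum>x\<in>Z. y k x * cnj (y l x)) = of_bool (k = l)"
    "\<forall>x\<in>Z. \<forall>z\<in>Z. (\<Sum>k\<in>Z. y k x * cnj (y k z)) = of_bool (x = z)"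
    "\<forall>x\<in>Z. \<forall>z\<in>Z. H x z = (\<Sum>k\<in>Z. of_real (\<kappa> k) * y k x * cnj (y k z))"
    using hermitian_spectral[of Z H, OF finZ H_herm] by (elim exE conjE) (rule that)
  note orth = this(1)[rule_format] and compl = this(2)[rule_format] and H_y = this(3)[rule_format]
  have H_eig: "(\<Sum>z\<in>Z. H x z * y k z) = of_real (\<kappa> k) * y k x" if "x \<in> Z" "k \<in> Z" for x k
  proof -
    have "(\<Sum>z\<in>Z. H x z * y k z) = (\<Sum>z\<in>Z. \<Sum>m\<in>Z. of_real (\<kappa> m) * y m x * (y k z * cnj (y m z)))"
      using H_y[OF that(1)] by (simp add: sum_distrib_left sum_distrib_right mult_ac)
    also have "\<dots> = (\<Sum>m\<in>Z. of_real (\<kappa> m) * y m x * (\<Sum>z\<in>Z. y k z * cnj (y m z)))"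
      by (subst sum.swap) (simp add: sum_distrib_left)
    also have "\<dots> = (\<Sum>m\<in>Z. of_real (\<kappa> m) * y m x * of_bool (k = m))"
      using orth that by (intro sum.cong refl) simp
    also have "\<dots> = of_real (\<kappa> k) * y k x" by (rule sum_of_bool(2)[OF finZ that(2)])
    finally show ?thesis .
  qed
  \<comment> \<open>\<open>q k\<close> is \<open>P\<close> applied to \<open>y k\<close>. The two
    forms are first computed on the \<open>q k\<close>, since an eigenvector with eigenvalue zero
    may lie outside the range of \<open>P\<close>.\<close>
  define q where "q k x = (\<Sum>z\<in>Z. P x z * y k z)" for k x
  have cq: "cnj (q k x) = (\<Sum>z\<in>Z. P z x * cnj (y k z))" if "x \<in> Z" for k x
    unfolding q_def cnj_sum using that herm by (intro sum.cong refl) simp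
  have q_form: "(\<Sum>w\<in>S. of_real (c w) * q k w * cnj (q l w))
    = (\<Sum>a\<in>Z. \<Sum>b\<in>Z. y k a * cnj (y l b) * (\<Sum>w\<in>S. of_real (c w) * P b w * P w a))"
    if "S \<subseteq> Z" for S k l and c :: "'z \<Rightarrow> real"
  proof -
    have "(\<Sum>w\<in>S. of_real (c w) * q k w * cnj (q l w))
      = (\<Sum>w\<in>S. of_real (c w) * (\<Sum>a\<in>Z. P w a * y k a) * (\<Sum>b\<in>Z. P b w * cnj (y l b)))"
      using that cq by (intro sum.cong refl) (auto simp: q_def)
    also have "\<dots> = (\<Sum>a\<in>Z. \<Sum>b\<in>Z. y k a * cnj (y l b) * (\<Sum>w\<in>S. of_real (c w) * P w a * P b w))"
      by (rule sum_bilinear)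
    finally show ?thesis by (simp add: mult_ac)
  qed
  have q_iso: "(\<Sum>w\<in>Z. of_real (ev w) * q k w * cnj (q l w)) = 0" for k l
    unfolding q_form[OF subset_refl] using iso by simp
  have q_pos: "(\<Sum>i\<in>X. of_real (ev i) * q k i * cnj (q l i)) = of_real (\<kappa> k) * of_bool (k = l)"
    if "k \<in> Z" "l \<in> Z" for k l
  proof -
    have "(\<Sum>i\<in>X. of_real (ev i) * q k i * cnj (q l i)) = (\<Sum>a\<in>Z. \<Sum>b\<in>Z. y k a * cnj (y l b) * H b a)"
      unfolding q_form[OF sub(1)] H_def ..
    also have "\<dots> = (\<Sum>b\<in>Z. cnj (y l b) * (\<Sum>a\<in>Z. H b a * y k a))"
      by (subst sum.swap) (simp add: sum_distrib_left mult_ac)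
    also have "\<dots> = (\<Sum>b\<in>Z. of_real (\<kappa> k) * (y k b * cnj (y l b)))"
      using H_eig that by (intro sum.cong refl) simp
    also have "\<dots> = of_real (\<kappa> k) * of_bool (k = l)"
      unfolding sum_distrib_left[symmetric] using orth that by simp
    finally show ?thesis .
  qed
  have q_neg: "(\<Sum>j\<in>W. of_real \<bar>ev j\<bar> * q k j * cnj (q l j)) = of_real (\<kappa> k) * of_bool (k = l)"
    if "k \<in> Z" "l \<in> Z" for k l
  proof -
    \<comment> \<open>The form of \<open>ev\<close> vanishes on the range of \<open>P\<close>, so
      its negative part takes the same values there as its positive part.\<close>
    have "0 = (\<Sum>w\<in>X \<union> W. of_real (ev w) * q k w * cnj (q l w))"
      unfolding q_iso[of k l, symmetric] using finZ
      by (intro sum.mono_neutral_right) (auto simp: X_def W_def)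
    also have "\<dots> = (\<Sum>i\<in>X. of_real (ev i) * q k i * cnj (q l i)) + (\<Sum>w\<in>W. of_real (ev w) * q k w * cnj (q l w))"
      using fin disj by (rule sum.union_disjoint)
    also have "(\<Sum>w\<in>W. of_real (ev w) * q k w * cnj (q l w)) = - (\<Sum>j\<in>W. of_real \<bar>ev j\<bar> * q k j * cnj (q l j))"
      unfolding sum_negf[symmetric] by (intro sum.cong refl) (auto simp: W_def)
    finally show ?thesis using q_pos[OF that] by simp
  qed
  have weighted_norm: "complex_of_real (\<Sum>i\<in>S. c i * (cmod (q k i))\<^sup>2) = (\<Sum>i\<in>S. of_real (c i) * q k i * cnj (q k i))"
    for S k and c :: "'z \<Rightarrow> real"
    by (simp add: complex_norm_square mult.assoc del: of_real_power)
  have norm_pos: "(\<Sum>i\<in>X. ev i * (cmod (q k i))\<^sup>2) = \<kappa> k" if "k \<in> Z" for k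
    using q_pos[OF that that] unfolding weighted_norm[symmetric]
    by (simp only: of_real_eq_iff simp_thms of_bool_eq mult_1_right)
  have norm_neg: "(\<Sum>j\<in>W. \<bar>ev j\<bar> * (cmod (q k j))\<^sup>2) = \<kappa> k" if "k \<in> Z" for k
    using q_neg[OF that that] unfolding weighted_norm[symmetric]
    by (simp only: of_real_eq_iff simp_thms of_bool_eq mult_1_right)
  have \<kappa>0: "\<kappa> k \<ge> 0" if "k \<in> Z" for k
    unfolding norm_pos[OF that, symmetric] by (intro sum_nonneg) (auto simp: X_def)
  \<comment> \<open>Both weighted norms of \<open>q k\<close> equal \<open>\<kappa> k\<close> and
    their weights are positive, so a zero eigenvalue forces \<open>q k\<close> to vanish off the
    kernel of \<open>ev\<close>.\<close>
  have q0: "q k x = 0" if "k \<in> Z" "\<kappa> k = 0" "x \<in> X \<union> W" for k x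
  proof -
    have "\<forall>i\<in>X. ev i * (cmod (q k i))\<^sup>2 = 0"
      using norm_pos[OF that(1)] that(2) fin by (subst sum_nonneg_eq_0_iff[symmetric]) (auto simp: X_def)
    moreover have "\<forall>j\<in>W. \<bar>ev j\<bar> * (cmod (q k j))\<^sup>2 = 0"
      using norm_neg[OF that(1)] that(2) fin by (subst sum_nonneg_eq_0_iff[symmetric]) auto
    ultimately show ?thesis using that(3) by (auto simp: X_def W_def)
  qed
  have PH: "(\<Sum>z\<in>Z. P x z * H z w) = H x w" if "x \<in> Z" for x w
  proof -
    have "(\<Sum>z\<in>Z. P x z * H z w) = (\<Sum>i\<in>X. of_real (ev i) * (\<Sum>z\<in>Z. P x z * P z i) * P i w)"
      unfolding H_def sum_distrib_left sum_distrib_right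
      by (subst sum.swap) (simp add: mult_ac)
    also have "\<dots> = H x w" unfolding H_def using idem that sub by (intro sum.cong refl) auto
    finally show ?thesis .
  qed
  \<comment> \<open>From \<open>P H = H\<close>, an eigenvector of \<open>H\<close> with nonzero
    eigenvalue is fixed by \<open>P\<close>.\<close>
  have q_y: "q k x = y k x" if "k \<in> Z" "\<kappa> k > 0" "x \<in> Z" for k x
  proof -
    have "of_real (\<kappa> k) * q k x = (\<Sum>z\<in>Z. P x z * (\<Sum>w\<in>Z. H z w * y k w))"
      unfolding q_def sum_distrib_left using H_eig that
      by (intro sum.cong refl) (simp add: sum_distrib_left[symmetric])
    also have "\<dots> = (\<Sum>w\<in>Z. (\<Sum>z\<in>Z. P x z * H z w) * y k w)"
      unfolding sum_distrib_left sum_distrib_right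
      by (subst sum.swap) (simp add: mult_ac)
    also have "\<dots> = of_real (\<kappa> k) * y k x" using PH H_eig that by simp
    finally show ?thesis using that(2) by simp
  qed
  \<comment> \<open>The remaining eigenvectors of \<open>P B P\<close> contribute nothing to the diagonal of \<open>P\<close> off the kernel
    of \<open>ev\<close>, so nothing is lost by keeping only those that lie in the range of \<open>P\<close>.\<close>
  define K where "K = {k \<in> Z. \<kappa> k > 0}"
  have finK: "finite K" using finZ by (simp add: K_def)
  have \<rho>: "(\<Sum>k\<in>K. (cmod (y k z))\<^sup>2) = Re (P z z)" if z: "z \<in> X \<union> W" for z
  proof -
    have zZ: "z \<in> Z" using z sub by auto
    have "(\<Sum>k\<in>K. (cmod (y k z))\<^sup>2) = (\<Sum>k\<in>K. (cmod (q k z))\<^sup>2)"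
      using q_y zZ by (intro sum.cong refl) (auto simp: K_def)
    also have "\<dots> = (\<Sum>k\<in>Z. (cmod (q k z))\<^sup>2)"
      using finZ q0[OF _ _ z] \<kappa>0 by (intro sum.mono_neutral_left) (force simp: K_def)+
    finally have "complex_of_real (\<Sum>k\<in>K. (cmod (y k z))\<^sup>2) = (\<Sum>k\<in>Z. 1 * q k z * cnj (q k z))"
      by (simp add: complex_norm_square del: of_real_power)
    also have "\<dots> = (\<Sum>k\<in>Z. 1 * (\<Sum>a\<in>Z. y k a * P z a) * (\<Sum>b\<in>Z. cnj (y k b) * P b z))"
      unfolding cq[OF zZ] by (simp add: q_def mult.commute)
    also have "\<dots> = (\<Sum>a\<in>Z. \<Sum>b\<in>Z. P z a * P b z * (\<Sum>k\<in>Z. 1 * y k a * cnj (y k b)))"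
      by (rule sum_bilinear)
    also have "\<dots> = (\<Sum>a\<in>Z. \<Sum>b\<in>Z. P z a * P b z * of_bool (a = b))"
      using compl by (intro sum.cong refl) simp
    also have "\<dots> = (\<Sum>a\<in>Z. P z a * P a z)"
      by (rule sum.cong[OF refl], rule sum_of_bool(2)[OF finZ])
    also have "\<dots> = P z z" by (rule idem[OF zZ zZ])
    finally show ?thesis by (metis Re_complex_of_real)
  qed
  have "\<exists>\<mu>. (\<forall>i j. \<mu> i j \<ge> 0) \<and>
    (\<forall>j\<in>Z. (\<Sum>i\<in>X. \<mu> i j) = (\<Sum>k\<in>K. (cmod (y k j))\<^sup>2)) \<and>
    (\<forall>i\<in>Z. ev i > 0 \<longrightarrow> (\<Sum>j\<in>W. \<bar>ev j\<bar> * \<mu> i j) = ev i * (\<Sum>k\<in>K. (cmod (y k i))\<^sup>2)) \<and>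
    (\<forall>p\<ge>0. (\<Sum>i\<in>X. ev i powr p * (\<Sum>j\<in>W. \<mu> i j))
      \<le> (\<Sum>i\<in>X. ev i powr p * (1 - (\<Sum>k\<in>K. (cmod (y k i))\<^sup>2))))"
    unfolding X_def W_def
  proof (rule coupling_exists[OF finK finZ])
    show "\<kappa> k > 0" if "k \<in> K" for k using that by (simp add: K_def)
    fix k l assume kl: "k \<in> K" "l \<in> K"
    show "(\<Sum>z\<in>Z. y k z * cnj (y l z)) = of_bool (k = l)" using orth kl by (simp add: K_def)
    show "(\<Sum>i | i \<in> Z \<and> 0 < ev i. of_real (ev i) * y k i * cnj (y l i)) = of_real (\<kappa> k) * of_bool (k = l)"
      using q_pos[of k l] kl q_y sub unfolding X_def[symmetric] K_def by (auto simp: subset_iff cong: sum.cong)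
    show "(\<Sum>j | j \<in> Z \<and> ev j < 0. of_real \<bar>ev j\<bar> * y k j * cnj (y l j)) = of_real (\<kappa> k) * of_bool (k = l)"
      using q_neg[of k l] kl q_y sub unfolding W_def[symmetric] K_def by (auto simp: subset_iff cong: sum.cong)
  qed
  note ex = this
  have "(\<Sum>i\<in>X. ev i powr p * (1 - (\<Sum>k\<in>K. (cmod (y k i))\<^sup>2)))
    = (\<Sum>i\<in>X. ev i powr p * (1 - Re (P i i)))" for p
    using \<rho> by (intro sum.cong refl) simp
  from ex[unfolded this] show ?thesis unfolding X_def[symmetric] W_def[symmetric]
    using \<rho> by (elim ex_forward) (auto simp: X_def W_def)
qed

section \<open>Energies and isotropic projections\<close>

text \<open>A concave power lies below its tangent at \<open>1\<close>. Adding the bounds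
  \<open>ln y \<le> y - 1\<close> at \<open>y = x / m\<close> and \<open>y = 1 / m\<close> with
  weights \<open>p\<close> and \<open>1 - p\<close> cancels the logarithms.\<close>

lemma powr_le_tangent:
  fixes x p :: real
  assumes "x > 0" "0 \<le> p" "p \<le> 1"
  shows "x powr p \<le> p * x + (1 - p)"
proof -
  define m where "m = x powr p"
  have m: "m > 0" using assms by (simp add: m_def)
  have lm: "ln m = p * ln x" using assms by (simp add: m_def ln_powr)
  have "ln (x / m) \<le> x / m - 1" "ln (1 / m) \<le> 1 / m - 1"
    using assms m by (intro ln_le_minus_one; simp)+
  then have *: "(1 - p) * ln x \<le> x / m - 1" "- (p * ln x) \<le> 1 / m - 1"
    using assms m lm by (simp_all add: ln_div algebra_simps)
  have "p * ((1 - p) * ln x) + (1 - p) * (- (p * ln x)) \<le> p * (x / m - 1) + (1 - p) * (1 / m - 1)"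
    using * assms by (intro add_mono mult_left_mono) auto
  then have "1 \<le> (p * x + (1 - p)) / m" by (simp add: algebra_simps add_divide_distrib diff_divide_distrib)
  then show ?thesis using m by (simp add: m_def)
qed

text \<open>The concave case for the base \<open>x powr p\<close> and the exponent
  \<open>1 / p\<close>.\<close>

lemma powr_ge_tangent:
  fixes x p :: real
  assumes "x > 0" "p \<ge> 1"
  shows "p * x \<le> x powr p + (p - 1)"
proof -
  have "(x powr p) powr (1 / p) \<le> 1 / p * x powr p + (1 - 1 / p)"
    using powr_le_tangent[of "x powr p" "1 / p"] assms by simp
  moreover have "(x powr p) powr (1 / p) = x" using assms by (simp add: powr_powr)
  ultimately have "x \<le> 1 / p * x powr p + (1 - 1 / p)" by simp
  then have "p * x \<le> p * (1 / p * x powr p + (1 - 1 / p))" using assms by (intro mult_left_mono) auto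
  also have "\<dots> = x powr p + (p - 1)" using assms by (simp add: algebra_simps)
  finally show ?thesis .
qed

text \<open>The tangent inequality at \<open>s / b\<close>, multiplied by
  \<open>b powr p\<close>.\<close>

lemma young_ge_one:
  fixes b s p :: real
  assumes "b > 0" "s > 0" "p \<ge> 1"
  shows "p * s * b powr (p - 1) \<le> s powr p + (p - 1) * b powr p"
proof -
  have "b powr p * (p * (s / b)) \<le> b powr p * ((s / b) powr p + (p - 1))"
    using powr_ge_tangent[of "s / b" p] assms by (intro mult_left_mono) auto
  moreover have "b powr p * (p * (s / b)) = p * s * b powr (p - 1)"
    using assms by (simp add: powr_diff)
  moreover have "b powr p * ((s / b) powr p + (p - 1)) = s powr p + (p - 1) * b powr p"
    using assms by (simp add: powr_divide algebra_simps)
  ultimately show ?thesis by simp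
qed

text \<open>The tangent inequality at \<open>c / s\<close>, multiplied by
  \<open>s powr p\<close>.\<close>

lemma young_le_one:
  fixes c s p :: real
  assumes "c > 0" "s > 0" "0 \<le> p" "p \<le> 1"
  shows "c powr p \<le> p * c * s powr (p - 1) + (1 - p) * s powr p"
proof -
  have "s powr p * (c / s) powr p \<le> s powr p * (p * (c / s) + (1 - p))"
    using powr_le_tangent[of "c / s" p] assms by (intro mult_left_mono) auto
  moreover have "s powr p * (c / s) powr p = c powr p"
    using assms by (simp add: powr_divide)
  moreover have "s powr p * (p * (c / s) + (1 - p)) = p * c * s powr (p - 1) + (1 - p) * s powr p"
    using assms by (simp add: powr_diff algebra_simps)
  ultimately show ?thesis by simp
qed

text \<open>Let \<open>R\<close> and \<open>S\<close> be the two energies weighted by the diagonal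
  of \<open>P\<close>. The trace hypotheses make the full energies \<open>1 + t\<close> times these,
  so it suffices to compare \<open>R\<close> with \<open>S\<close>, by integrating Young's
  inequality against the coupling. The reverse comparisons come from the same lemma for
  \<open>- ev\<close>.\<close>

lemma energy_bound:
  fixes P :: "'z \<Rightarrow> 'z \<Rightarrow> complex" and ev :: "'z \<Rightarrow> real" and p t :: real
  assumes finZ: "finite Z"
    and herm: "\<forall>x\<in>Z. \<forall>z\<in>Z. cnj (P x z) = P z x"
    and idem: "\<forall>x\<in>Z. \<forall>z\<in>Z. (\<Sum>y\<in>Z. P x y * P y z) = P x z"
    and iso: "\<forall>x\<in>Z. \<forall>z\<in>Z. (\<Sum>y\<in>Z. of_real (ev y) * P x y * P y z) = 0"
    and t: "t > 0" and p: "p \<ge> 0"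
    and trp: "(1 + t) * (\<Sum>i | i \<in> Z \<and> ev i > 0. ev i powr p * Re (P i i))
      = (\<Sum>i | i \<in> Z \<and> ev i > 0. ev i powr p)"
    and trn: "(1 + t) * (\<Sum>j | j \<in> Z \<and> ev j < 0. \<bar>ev j\<bar> powr p * Re (P j j))
      = (\<Sum>j | j \<in> Z \<and> ev j < 0. \<bar>ev j\<bar> powr p)"
  shows "p \<ge> 1 \<Longrightarrow> (\<Sum>i | i \<in> Z \<and> ev i > 0. ev i powr p)
      \<le> t powr (p - 1) * (\<Sum>j | j \<in> Z \<and> ev j < 0. \<bar>ev j\<bar> powr p)"
    and "p < 1 \<Longrightarrow> (\<Sum>j | j \<in> Z \<and> ev j < 0. \<bar>ev j\<bar> powr p)
      \<le> t powr (1 - p) * (\<Sum>i | i \<in> Z \<and> ev i > 0. ev i powr p)"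
proof -
  define X where "X = {i. i \<in> Z \<and> ev i > 0}"
  define W where "W = {j. j \<in> Z \<and> ev j < 0}"
  obtain \<mu> where \<mu>0: "\<forall>i j. \<mu> i j \<ge> 0"
    and \<mu>1: "\<forall>j\<in>Z. ev j < 0 \<longrightarrow> (\<Sum>i\<in>X. \<mu> i j) = Re (P j j)"
    and \<mu>2: "\<forall>i\<in>Z. ev i > 0 \<longrightarrow> (\<Sum>j\<in>W. \<bar>ev j\<bar> * \<mu> i j) = ev i * Re (P i i)"
    and \<mu>3: "\<forall>p\<ge>0. (\<Sum>i\<in>X. ev i powr p * (\<Sum>j\<in>W. \<mu> i j)) \<le> (\<Sum>i\<in>X. ev i powr p * (1 - Re (P i i)))"
    using projection_coupling[OF finZ herm idem iso] unfolding X_def[symmetric] W_def[symmetric]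
    by (elim exE conjE) (rule that)
  define R where "R = (\<Sum>i\<in>X. ev i powr p * Re (P i i))"
  define S where "S = (\<Sum>j\<in>W. \<bar>ev j\<bar> powr p * Re (P j j))"
  note tr = trp[folded X_def, folded R_def] trn[folded W_def, folded S_def]
  have S_\<mu>: "(\<Sum>i\<in>X. \<Sum>j\<in>W. \<bar>ev j\<bar> powr p * \<mu> i j) = S"
    unfolding S_def using \<mu>1
    by (subst sum.swap) (auto simp: W_def sum_distrib_left[symmetric] intro!: sum.cong)
  \<comment> \<open>Summing over \<open>j\<close> first, the weighted marginal supplies one factor
    \<open>ev i\<close> and raises the exponent from \<open>p - 1\<close> to
    \<open>p\<close>.\<close>
  have R_\<mu>: "(\<Sum>i\<in>X. \<Sum>j\<in>W. ev i powr (p - 1) * (\<bar>ev j\<bar> * \<mu> i j)) = R"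
    unfolding R_def sum_distrib_left[symmetric] using \<mu>2
    by (intro sum.cong refl) (auto simp: X_def powr_diff)
  \<comment> \<open>The moment bound is the positive energy minus \<open>R\<close>, that is
    \<open>(1 + t) * R - R\<close>.\<close>
  have T_\<mu>: "(\<Sum>i\<in>X. \<Sum>j\<in>W. ev i powr p * \<mu> i j) \<le> t * R"
  proof -
    have "(\<Sum>i\<in>X. \<Sum>j\<in>W. ev i powr p * \<mu> i j) \<le> (\<Sum>i\<in>X. ev i powr p * (1 - Re (P i i)))"
      using \<mu>3[rule_format, OF p] by (simp add: sum_distrib_left)
    also have "\<dots> = (\<Sum>i\<in>X. ev i powr p) - R"
      by (simp add: R_def right_diff_distrib sum_subtractf)
    finally show ?thesis using tr(1) by (simp add: algebra_simps)
  qed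
  {
    assume p1: "p \<ge> 1"
    \<comment> \<open>Scaling the negative eigenvalues by \<open>t\<close> gives
      \<open>p * t * R\<close> on the left and \<open>(p - 1) * t * R\<close> on the right, so
      exactly one \<open>t * R\<close> survives.\<close>
    have "(\<Sum>i\<in>X. \<Sum>j\<in>W. (p * (t * \<bar>ev j\<bar>) * ev i powr (p - 1)) * \<mu> i j)
      \<le> (\<Sum>i\<in>X. \<Sum>j\<in>W. ((t * \<bar>ev j\<bar>) powr p + (p - 1) * ev i powr p) * \<mu> i j)"
      using p1 t \<mu>0 by (intro sum_mono mult_right_mono young_ge_one) (auto simp: X_def W_def mult_pos_neg)
    also have "\<dots> = t powr p * (\<Sum>i\<in>X. \<Sum>j\<in>W. \<bar>ev j\<bar> powr p * \<mu> i j)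
        + (p - 1) * (\<Sum>i\<in>X. \<Sum>j\<in>W. ev i powr p * \<mu> i j)"
      unfolding sum_distrib_left sum.distrib[symmetric]
      using t by (intro sum.cong refl) (simp add: powr_mult algebra_simps)
    also have "\<dots> \<le> t powr p * S + (p - 1) * (t * R)"
      using S_\<mu> T_\<mu> p1 by (intro add_mono mult_left_mono) auto
    also have "(\<Sum>i\<in>X. \<Sum>j\<in>W. (p * (t * \<bar>ev j\<bar>) * ev i powr (p - 1)) * \<mu> i j) = p * t * R"
      unfolding R_\<mu>[symmetric] sum_distrib_left by (intro sum.cong refl) simp
    finally have "t * R \<le> t powr p * S" by (simp add: algebra_simps)
    also have "t powr p = t * t powr (p - 1)" using t by (simp add: powr_diff)
    finally have "R \<le> t powr (p - 1) * S" using t by simp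
    then have "(1 + t) * R \<le> (1 + t) * (t powr (p - 1) * S)" using t by (intro mult_left_mono) auto
    then show "(\<Sum>i | i \<in> Z \<and> ev i > 0. ev i powr p)
      \<le> t powr (p - 1) * (\<Sum>j | j \<in> Z \<and> ev j < 0. \<bar>ev j\<bar> powr p)"
      unfolding X_def[symmetric] W_def[symmetric] tr[symmetric] by (simp add: mult.left_commute)
  next
    assume p1: "p < 1"
    \<comment> \<open>Comparing with \<open>ev i / t\<close> makes both terms multiples of
      \<open>t powr (1 - p) * R\<close>, with coefficients \<open>p\<close> and \<open>1 - p\<close>
      that add up to one.\<close>
    have "S \<le> (\<Sum>i\<in>X. \<Sum>j\<in>W. (p * \<bar>ev j\<bar> * (ev i / t) powr (p - 1) + (1 - p) * (ev i / t) powr p) * \<mu> i j)"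
      unfolding S_\<mu>[symmetric]
      using p p1 t \<mu>0 by (intro sum_mono mult_right_mono young_le_one) (auto simp: X_def W_def)
    also have "\<dots> = p * t powr (1 - p) * (\<Sum>i\<in>X. \<Sum>j\<in>W. ev i powr (p - 1) * (\<bar>ev j\<bar> * \<mu> i j))
        + (1 - p) * t powr (- p) * (\<Sum>i\<in>X. \<Sum>j\<in>W. ev i powr p * \<mu> i j)"
    proof -
      have *: "(x / t) powr (p - 1) = t powr (1 - p) * x powr (p - 1)"
        "(x / t) powr p = t powr (- p) * x powr p" if "x > 0" for x
        using t that powr_minus_divide[of t "1 - p"] powr_minus_divide[of t "p"]
        by (simp_all add: powr_divide powr_diff powr_minus)
      show ?thesis unfolding sum_distrib_left sum.distrib[symmetric]
        by (intro sum.cong refl) (simp add: X_def * algebra_simps)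
    qed
    also have "\<dots> \<le> p * t powr (1 - p) * R + (1 - p) * t powr (- p) * (t * R)"
      unfolding R_\<mu> using T_\<mu> p1 by (intro add_mono mult_left_mono order_refl) auto
    also have "\<dots> = t powr (1 - p) * R"
      using t by (simp add: powr_diff powr_minus divide_simps) (simp add: algebra_simps)
    finally have "(1 + t) * S \<le> (1 + t) * (t powr (1 - p) * R)" using t by (intro mult_left_mono) auto
    then show "(\<Sum>j | j \<in> Z \<and> ev j < 0. \<bar>ev j\<bar> powr p)
      \<le> t powr (1 - p) * (\<Sum>i | i \<in> Z \<and> ev i > 0. ev i powr p)"
      unfolding X_def[symmetric] W_def[symmetric] tr[symmetric] by (simp add: mult.left_commute)
  }
qed

section \<open>The adjacency spectrum\<close>

lemma order_prod_linear_factors: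
  fixes f :: "nat \<Rightarrow> 'a::field"
  shows "order x (\<Prod>a\<leftarrow>map f [0..<n]. [:- a, 1:]) = card {k. k < n \<and> f k = x}"
proof (induction n)
  case (Suc n)
  have nz: "(\<Prod>a\<leftarrow>xs. [:- a, 1:]) \<noteq> (0 :: 'a poly)" for xs by (auto simp: prod_list_zero_iff)
  have "{k. k < Suc n \<and> f k = x} = {k. k < n \<and> f k = x} \<union> (if f n = x then {n} else {})"
    by (auto simp: less_Suc_eq)
  moreover have "order x [:- f n, 1:] = (if f n = x then 1 else 0)"
    using order_power_n_n[of x 1] by (auto intro: order_0I)
  ultimately show ?case
    using Suc.IH nz[of "map f [0..<n]"] by (simp add: order_mult del: mult_pCons_right)
qed simp

text \<open>Grouping the indices \<open>k\<close> by the value \<open>f k\<close> produces each root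
  as often as its order. This turns the energies into sums over a list of eigenvalues.\<close>

lemma sum_over_roots:
  fixes f :: "nat \<Rightarrow> 'a::field" and g :: "'a \<Rightarrow> real"
  assumes q: "q = (\<Prod>a\<leftarrow>map f [0..<n]. [:- a, 1:])"
  shows "(\<Sum>x\<in>{x. A x \<and> poly q x = 0}. real (order x q) * g x) = (\<Sum>k | k < n \<and> A (f k). g (f k))"
proof -
  have "q \<noteq> 0" unfolding q by (auto simp: prod_list_zero_iff)
  then have roots: "poly q x = 0 \<longleftrightarrow> (\<exists>k<n. f k = x)" for x
    unfolding order_root q order_prod_linear_factors by (auto simp: card_eq_0_iff)
  have img: "{x. A x \<and> poly q x = 0} = f ` {k. k < n \<and> A (f k)}" using roots by auto
  have "(\<Sum>k | k < n \<and> A (f k). g (f k))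
    = (\<Sum>x\<in>f ` {k. k < n \<and> A (f k)}. \<Sum>k | k \<in> {k. k < n \<and> A (f k)} \<and> f k = x. g (f k))"
    by (rule sum.image_gen) simp
  also have "\<dots> = (\<Sum>x\<in>{x. A x \<and> poly q x = 0}. real (order x q) * g x)"
    unfolding img
  proof (rule sum.cong[OF refl])
    fix x assume x: "x \<in> f ` {k. k < n \<and> A (f k)}"
    have "(\<Sum>k | k \<in> {k. k < n \<and> A (f k)} \<and> f k = x. g (f k)) = (\<Sum>k | k < n \<and> f k = x. g x)"
      using x by (intro sum.cong) auto
    then show "(\<Sum>k | k \<in> {k. k < n \<and> A (f k)} \<and> f k = x. g (f k)) = real (order x q) * g x"
      unfolding q order_prod_linear_factors by simp
  qed
  finally show ?thesis by simp
qed

text \<open>The eigenbasis makes \<open>M\<close> similar over the complex numbers to the diagonal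
  matrix of \<open>\<kappa>\<close>. The resulting equality of polynomials descends to the reals
  coefficient by coefficient.\<close>

lemma char_poly_spectral:
  fixes M :: "real mat" and y :: "nat \<Rightarrow> nat \<Rightarrow> complex" and \<kappa> :: "nat \<Rightarrow> real"
  assumes M: "M \<in> carrier_mat n n"
    and orth: "\<And>k l. k < n \<Longrightarrow> l < n \<Longrightarrow> (\<Sum>x<n. y k x * cnj (y l x)) = of_bool (k = l)"
    and compl: "\<And>x z. x < n \<Longrightarrow> z < n \<Longrightarrow> (\<Sum>k<n. y k x * cnj (y k z)) = of_bool (x = z)"
    and dec: "\<And>x z. x < n \<Longrightarrow> z < n \<Longrightarrow>
      of_real (M $$ (x,z)) = (\<Sum>k<n. of_real (\<kappa> k) * y k x * cnj (y k z))"
  shows "char_poly M = (\<Prod>a\<leftarrow>map \<kappa> [0..<n]. [:- a, 1:])"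
proof -
  let ?M = "map_mat complex_of_real M"
  define D where "D = mat n n (\<lambda>(i,j). if i = j then complex_of_real (\<kappa> i) else 0)"
  define Y where "Y = mat n n (\<lambda>(i,k). y k i)"
  define Y' where "Y' = mat n n (\<lambda>(k,j). cnj (y k j))"
  have c: "D \<in> carrier_mat n n" "Y \<in> carrier_mat n n" "Y' \<in> carrier_mat n n" "?M \<in> carrier_mat n n"
    using M by (auto simp: D_def Y_def Y'_def)
  have "Y * Y' = 1\<^sub>m n"
    by (rule eq_matI) (auto simp: Y_def Y'_def scalar_prod_def compl atLeast0LessThan)
  moreover have "Y' * Y = 1\<^sub>m n"
    by (rule eq_matI) (auto simp: Y_def Y'_def scalar_prod_def orth atLeast0LessThan mult.commute[of "cnj _"])
  moreover define G where "G = Y * D"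
  have G: "G \<in> carrier_mat n n" using c by (simp add: G_def)
  have "?M = G * Y'"
  proof (rule eq_matI)
    fix i j assume "i < dim_row (G * Y')" "j < dim_col (G * Y')"
    then have ij: "i < n" "j < n" using c G by auto
    have YD: "G $$ (i,k) = of_real (\<kappa> k) * y k i" if "k < n" for k
      using that ij by (simp add: G_def Y_def D_def scalar_prod_def if_distrib cong: if_cong)
    have "(G * Y') $$ (i,j) = (\<Sum>k<n. G $$ (i,k) * Y' $$ (k,j))"
      using c G ij by (auto simp: scalar_prod_def atLeast0LessThan intro!: sum.cong)
    also have "\<dots> = ?M $$ (i,j)"
      using dec[OF ij] ij M YD by (auto simp: Y'_def intro!: sum.cong)
    finally show "?M $$ (i,j) = (G * Y') $$ (i,j)" by simp
  qed (use c G M in auto)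
  ultimately have "similar_mat ?M D"
    using c M unfolding G_def similar_mat_def similar_mat_wit_def Let_def
    by (intro exI[of _ Y] exI[of _ Y']) simp
  then have "char_poly ?M = char_poly D" by (rule char_poly_similar)
  also have "\<dots> = (\<Prod>a\<leftarrow>diag_mat D. [:- a, 1:])"
    by (rule char_poly_upper_triangular[OF c(1)]) (auto simp: D_def)
  also have "diag_mat D = map (\<lambda>k. complex_of_real (\<kappa> k)) [0..<n]"
    by (auto simp: diag_mat_def D_def)
  finally have "map_poly complex_of_real (char_poly M) = (\<Prod>a\<leftarrow>map (\<lambda>k. complex_of_real (\<kappa> k)) [0..<n]. [:- a, 1:])"
    using of_real_hom.char_poly_hom[OF M, where 'a = complex] by simp
  also have "\<dots> = map_poly complex_of_real (\<Prod>a\<leftarrow>map \<kappa> [0..<n]. [:- a, 1:])"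
  proof -
    interpret h: map_poly_comm_ring_hom "of_real :: real \<Rightarrow> complex" ..
    show ?thesis by (simp add: h.hom_prod_list o_def)
  qed
  finally have "complex_of_real (coeff (char_poly M) i) = complex_of_real (coeff (\<Prod>a\<leftarrow>map \<kappa> [0..<n]. [:- a, 1:]) i)" for i
    by (metis coeff_map_poly of_real_0)
  then show ?thesis by (intro poly_eqI) simp
qed

text \<open>Joins the energies, which are read off the characteristic polynomial, to an explicit
  orthonormal eigenbasis in which a representation can be expanded.\<close>

lemma adjacency_spectrum:
  assumes "simple_graph n E"
  shows "\<exists>e \<kappa>. (\<forall>k<n. \<forall>l<n. (\<Sum>v<n. e k v * cnj (e l v)) = of_bool (k = l)) \<and>
    (\<forall>v<n. \<forall>w<n. (\<Sum>k<n. e k v * cnj (e k w)) = of_bool (v = w)) \<and>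
    (\<forall>v<n. \<forall>w<n. (\<Sum>k<n. of_real (\<kappa> k) * e k v * cnj (e k w)) = of_bool (E v w)) \<and>
    (\<forall>p. pos_energy p n E = (\<Sum>k | k < n \<and> \<kappa> k > 0. \<kappa> k powr p)) \<and>
    (\<forall>p. neg_energy p n E = (\<Sum>k | k < n \<and> \<kappa> k < 0. \<bar>\<kappa> k\<bar> powr p))"
proof -
  define H :: "nat \<Rightarrow> nat \<Rightarrow> complex" where "H v w = of_bool (E v w)" for v w
  have "E v w \<longleftrightarrow> E w v" for v w using assms by (auto simp: simple_graph_def)
  then have herm: "\<forall>v\<in>{..<n}. \<forall>w\<in>{..<n}. cnj (H v w) = H w v" by (auto simp: H_def)
  obtain e \<kappa> where
    e: "\<forall>k\<in>{..<n}. \<forall>l\<in>{..<n}. (\<Sum>v<n. e k v * cnj (e l v)) = of_bool (k = l)"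
    "\<forall>v\<in>{..<n}. \<forall>w\<in>{..<n}. (\<Sum>k<n. e k v * cnj (e k w)) = of_bool (v = w)"
    "\<forall>v\<in>{..<n}. \<forall>w\<in>{..<n}. H v w = (\<Sum>k<n. of_real (\<kappa> k) * e k v * cnj (e k w))"
    using hermitian_spectral[OF finite_lessThan herm] by (elim exE conjE) (rule that)
  have e3: "(\<Sum>k<n. of_real (\<kappa> k) * e k v * cnj (e k w)) = of_bool (E v w)" if "v < n" "w < n" for v w
    using e(3) that unfolding H_def by (metis lessThan_iff)
  have "char_poly (adj_mat n E) = (\<Prod>a\<leftarrow>map \<kappa> [0..<n]. [:- a, 1:])"
  proof (rule char_poly_spectral)
    show "adj_mat n E \<in> carrier_mat n n" by (simp add: adj_mat_def)
    show "of_real (adj_mat n E $$ (v,w)) = (\<Sum>k<n. of_real (\<kappa> k) * e k v * cnj (e k w))"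
      if "v < n" "w < n" for v w
      unfolding e3[OF that] using that by (simp add: adj_mat_def)
  qed (use e in auto)
  note energy = sum_over_roots[OF this]
  have "pos_energy p n E = (\<Sum>k | k < n \<and> \<kappa> k > 0. \<kappa> k powr p)" for p
    unfolding pos_energy_def Let_def by (rule energy)
  moreover have "neg_energy p n E = (\<Sum>k | k < n \<and> \<kappa> k < 0. \<bar>\<kappa> k\<bar> powr p)" for p
    unfolding neg_energy_def Let_def by (rule energy)
  ultimately show ?thesis using e(1,2) e3 by (intro exI[of _ e] exI[of _ \<kappa>]) simp
qed

section \<open>The energy bound for projective representations\<close>

lemma mat_adjoint_index:
  fixes A :: "complex mat"
  assumes "A \<in> carrier_mat d d" "i < d" "j < d"
  shows "mat_adjoint A $$ (i,j) = cnj (A $$ (j,i))"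
  using assms by (simp add: mat_adjoint_def mat_of_rows_def)

text \<open>Passes from matrices to kernels, the form used by the spectral lemmas, and replaces the
  rank by the trace, which is linear.\<close>

lemma representation_entries:
  assumes "has_representation n E d r"
  obtains p :: "nat \<Rightarrow> nat \<Rightarrow> nat \<Rightarrow> complex" where
    "\<And>v a b. v < n \<Longrightarrow> a < d \<Longrightarrow> b < d \<Longrightarrow> cnj (p v a b) = p v b a"
    "\<And>v a c. v < n \<Longrightarrow> a < d \<Longrightarrow> c < d \<Longrightarrow> (\<Sum>b<d. p v a b * p v b c) = p v a c"
    "\<And>v w a c. v < n \<Longrightarrow> w < n \<Longrightarrow> E v w \<Longrightarrow> a < d \<Longrightarrow> c < d \<Longrightarrow> (\<Sum>b<d. p v a b * p w b c) = 0"
    "\<And>v. v < n \<Longrightarrow> (\<Sum>a<d. p v a a) = of_nat r"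
proof -
  obtain P where P: "\<And>v. v < n \<Longrightarrow> orth_projector d (P v)" "\<And>v. v < n \<Longrightarrow> vec_space.rank d (P v) = r"
    and E: "\<And>u v. u < n \<Longrightarrow> v < n \<Longrightarrow> E u v \<Longrightarrow> P u * P v = 0\<^sub>m d d"
    using assms unfolding has_representation_def by metis
  have c: "P v \<in> carrier_mat d d" and i: "P v * P v = P v" and h: "mat_adjoint (P v) = P v" if "v < n" for v
    using P(1)[OF that] by (auto simp: orth_projector_def)
  have prod: "(P v * P w) $$ (a,b) = (\<Sum>k<d. P v $$ (a,k) * P w $$ (k,b))"
    if "v < n" "w < n" "a < d" "b < d" for v w a b
    using c[OF that(1)] c[OF that(2)] that by (auto simp: scalar_prod_def atLeast0LessThan intro!: sum.cong)
  show ?thesis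
  proof (rule that[of "\<lambda>v a b. P v $$ (a,b)"])
    show "cnj (P v $$ (a,b)) = P v $$ (b,a)" if "v < n" "a < d" "b < d" for v a b
      using mat_adjoint_index[OF c[OF that(1)] that(3,2)] h[OF that(1)] by simp
    show "(\<Sum>b<d. P v $$ (a,b) * P v $$ (b,c)) = P v $$ (a,c)" if "v < n" "a < d" "c < d" for v a c
      using prod[OF that(1,1,2,3)] i[OF that(1)] by simp
    show "(\<Sum>b<d. P v $$ (a,b) * P w $$ (b,c)) = 0" if "v < n" "w < n" "E v w" "a < d" "c < d" for v w a c
      using prod[OF that(1,2,4,5)] E[OF that(1-3)] that by simp
    show "(\<Sum>a<d. P v $$ (a,a)) = of_nat r" if "v < n" for v
      using idempotent_rank_eq_trace[OF c i] P(2) that by simp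
  qed
qed

text \<open>The projections at the two ends of an edge add up to a projection of trace
  \<open>2 * r\<close>, and the diagonal entries of a projection are at most
  \<open>1\<close>.\<close>

lemma representation_dim_ge:
  assumes rep: "has_representation n E d r" and G: "simple_graph n E" and uv: "E u v"
  shows "2 * r \<le> d"
proof -
  obtain p :: "nat \<Rightarrow> nat \<Rightarrow> nat \<Rightarrow> complex" where
    herm: "\<And>v a b. v < n \<Longrightarrow> a < d \<Longrightarrow> b < d \<Longrightarrow> cnj (p v a b) = p v b a" and
    idem: "\<And>v a c. v < n \<Longrightarrow> a < d \<Longrightarrow> c < d \<Longrightarrow> (\<Sum>b<d. p v a b * p v b c) = p v a c" and
    orth: "\<And>v w a c. v < n \<Longrightarrow> w < n \<Longrightarrow> E v w \<Longrightarrow> a < d \<Longrightarrow> c < d \<Longrightarrow> (\<Sum>b<d. p v a b * p w b c) = 0" and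
    tr: "\<And>v. v < n \<Longrightarrow> (\<Sum>a<d. p v a a) = of_nat r"
    by (rule representation_entries[OF rep]) (rule that)
  have n: "u < n" "v < n" and vu: "E v u" using G uv by (auto simp: simple_graph_def)
  define q where "q a b = p u a b + p v a b" for a b
  have le1: "Re (q a a) \<le> 1" if a: "a < d" for a
  proof -
    have "q a a = (\<Sum>b<d. p u a b * p u b a) + (\<Sum>b<d. p u a b * p v b a)
        + (\<Sum>b<d. p v a b * p u b a) + (\<Sum>b<d. p v a b * p v b a)"
      using idem orth n uv vu a by (simp add: q_def)
    also have "\<dots> = (\<Sum>b<d. q a b * cnj (q a b))"
      unfolding sum.distrib[symmetric] using herm n a
      by (intro sum.cong refl) (simp add: q_def algebra_simps)
    also have "\<dots> = of_real (\<Sum>b<d. (cmod (q a b))\<^sup>2)"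
      by (simp add: complex_norm_square del: of_real_power)
    finally have q: "q a a = of_real (\<Sum>b<d. (cmod (q a b))\<^sup>2)" .
    \<comment> \<open>A diagonal entry of a Hermitian idempotent is the squared norm of its row.
      That row contains the entry itself, hence \<open>s\<^sup>2 \<le> s\<close>.\<close>
    define s where "s = (\<Sum>b<d. (cmod (q a b))\<^sup>2)"
    have "(cmod (q a a))\<^sup>2 \<le> s" unfolding s_def using a by (intro member_le_sum) auto
    moreover have "cmod (q a a) = \<bar>s\<bar>" using q[folded s_def] by (simp only: norm_of_real)
    ultimately have "s * s \<le> s * 1" by (simp add: power2_eq_square)
    moreover have "s \<ge> 0" unfolding s_def by (intro sum_nonneg) simp
    ultimately have "s \<le> 1" by (cases "s = 0") auto
    then show ?thesis using q[folded s_def] by simp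
  qed
  have "complex_of_real (2 * real r) = (\<Sum>a<d. q a a)" using tr n by (simp add: q_def sum.distrib)
  then have "2 * real r = Re (\<Sum>a<d. q a a)" by (metis Re_complex_of_real)
  also have "\<dots> = (\<Sum>a<d. Re (q a a))" by simp
  also have "\<dots> \<le> (\<Sum>a<d. 1)" using le1 by (intro sum_mono) simp
  finally show ?thesis by simp
qed

lemma sum_times_fibre:
  fixes \<kappa> :: "nat \<Rightarrow> real" and h :: "real \<Rightarrow> real" and d :: nat
  shows "(\<Sum>i | i \<in> {..<n} \<times> {..<d} \<and> A (\<kappa> (fst i)). h (\<kappa> (fst i)) * G i)
    = (\<Sum>k | k < n \<and> A (\<kappa> k). h (\<kappa> k) * (\<Sum>a<d. G (k,a)))"
proof -
  have "{i. i \<in> {..<n} \<times> {..<d::nat} \<and> A (\<kappa> (fst i))} = {k. k < n \<and> A (\<kappa> k)} \<times> {..<d}" by auto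
  then show ?thesis
    by (simp add: sum.cartesian_product' sum_distrib_left)
qed

text \<open>\<open>Q\<close> is the block diagonal projection with one block per vertex, written in
  the eigenbasis of the adjacency matrix. There the adjacency matrix tensored with the identity is
  the diagonal \<open>ev\<close>, so \<open>energy_bound\<close> applies to \<open>ev\<close> and to
  \<open>- ev\<close>. Every eigenvalue occurs \<open>d\<close> times, a factor that
  cancels.\<close>

lemma representation_energy_bound:
  assumes rep: "has_representation n E d r" and G: "simple_graph n E" and uv: "E u v"
    and r: "r > 0" and p: "p \<ge> 0"
  defines "t \<equiv> real d / real r - 1"
  shows "t \<ge> 1" "pos_energy p n E \<le> t powr \<bar>p - 1\<bar> * neg_energy p n E"
    "neg_energy p n E \<le> t powr \<bar>p - 1\<bar> * pos_energy p n E"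
proof -
  have "real (2 * r) \<le> real d" using representation_dim_ge[OF rep G uv] by (simp only: of_nat_le_iff)
  then show t1: "t \<ge> 1" using r by (simp add: t_def field_simps)
  have t0: "t > 0" using t1 by simp
  obtain q :: "nat \<Rightarrow> nat \<Rightarrow> nat \<Rightarrow> complex" where
    herm: "\<And>v a b. v < n \<Longrightarrow> a < d \<Longrightarrow> b < d \<Longrightarrow> cnj (q v a b) = q v b a" and
    idem: "\<And>v a c. v < n \<Longrightarrow> a < d \<Longrightarrow> c < d \<Longrightarrow> (\<Sum>b<d. q v a b * q v b c) = q v a c" and
    orth: "\<And>v w a c. v < n \<Longrightarrow> w < n \<Longrightarrow> E v w \<Longrightarrow> a < d \<Longrightarrow> c < d \<Longrightarrow> (\<Sum>b<d. q v a b * q w b c) = 0" and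
    tr: "\<And>v. v < n \<Longrightarrow> (\<Sum>a<d. q v a a) = of_nat r"
    by (rule representation_entries[OF rep]) (rule that)
  obtain e \<kappa> where
    "\<forall>k<n. \<forall>l<n. (\<Sum>v<n. e k v * cnj (e l v)) = of_bool (k = l)"
    "\<forall>v<n. \<forall>w<n. (\<Sum>k<n. e k v * cnj (e k w)) = of_bool (v = w)"
    "\<forall>v<n. \<forall>w<n. (\<Sum>k<n. of_real (\<kappa> k) * e k v * cnj (e k w)) = of_bool (E v w)"
    "\<forall>p. pos_energy p n E = (\<Sum>k | k < n \<and> \<kappa> k > 0. \<kappa> k powr p)"
    "\<forall>p. neg_energy p n E = (\<Sum>k | k < n \<and> \<kappa> k < 0. \<bar>\<kappa> k\<bar> powr p)"
    using adjacency_spectrum[OF G] by (elim exE conjE) (rule that)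
  note e_orth = this(1)[rule_format] and e_compl = this(2)[rule_format] and e_adj = this(3)[rule_format]
    and pos = this(4)[rule_format] and neg = this(5)[rule_format]
  define Z where "Z = {..<n} \<times> {..<d}"
  define Q where "Q = (\<lambda>(k,a) (l,b). \<Sum>v<n. cnj (e k v) * e l v * q v a b)"
  define ev where "ev i = \<kappa> (fst i)" for i :: "nat \<times> nat"
  have finZ: "finite Z" by (simp add: Z_def)
  \<comment> \<open>The weight \<open>c\<close> selects the use: \<open>1\<close> collapses the
    inner sum over \<open>l\<close> by completeness, and \<open>\<kappa>\<close> turns it into an
    entry of the adjacency matrix.\<close>
  have Q_prod: "(\<Sum>y\<in>Z. c (fst y) * Q (k,a) y * Q y (m,f))
    = (\<Sum>v<n. \<Sum>w<n. cnj (e k v) * e m w * ((\<Sum>l<n. c l * e l v * cnj (e l w)) * (\<Sum>b<d. q v a b * q w b f)))"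
    for c k a m f
  proof -
    have "(\<Sum>y\<in>Z. c (fst y) * Q (k,a) y * Q y (m,f))
      = (\<Sum>y\<in>Z. c (fst y) * (\<Sum>v<n. (e (fst y) v * q v a (snd y)) * cnj (e k v))
          * (\<Sum>w<n. (cnj (e (fst y) w) * q w (snd y) f) * e m w))"
      by (intro sum.cong refl) (auto simp: Q_def mult_ac split: prod.split)
    also have "\<dots> = (\<Sum>v<n. \<Sum>w<n. cnj (e k v) * e m w *
        (\<Sum>y\<in>Z. c (fst y) * (e (fst y) v * q v a (snd y)) * (cnj (e (fst y) w) * q w (snd y) f)))"
      by (rule sum_bilinear)
    also have "\<dots> = (\<Sum>v<n. \<Sum>w<n. cnj (e k v) * e m w *
        ((\<Sum>l<n. c l * e l v * cnj (e l w)) * (\<Sum>b<d. q v a b * q w b f)))"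
      unfolding Z_def sum_product sum.cartesian_product'
      by (simp add: mult_ac)
    finally show ?thesis .
  qed
  have Q_herm: "\<forall>x\<in>Z. \<forall>z\<in>Z. cnj (Q x z) = Q z x"
    using herm by (auto simp: Q_def Z_def mult_ac intro!: sum.cong)
  have Q_idem: "\<forall>x\<in>Z. \<forall>z\<in>Z. (\<Sum>y\<in>Z. Q x y * Q y z) = Q x z"
  proof (intro ballI)
    fix x z assume "x \<in> Z" "z \<in> Z"
    then obtain k a m f where x: "x = (k,a)" "z = (m,f)" and b: "k < n" "a < d" "m < n" "f < d"
      by (auto simp: Z_def)
    have "(\<Sum>y\<in>Z. Q x y * Q y z) = (\<Sum>v<n. \<Sum>w<n. cnj (e k v) * e m w *
        ((\<Sum>l<n. e l v * cnj (e l w)) * (\<Sum>b<d. q v a b * q w b f)))"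
      using Q_prod[of "\<lambda>_. 1" k a m f] by (simp add: x)
    also have "\<dots> = (\<Sum>v<n. \<Sum>w<n. cnj (e k v) * e m w * (\<Sum>b<d. q v a b * q w b f) * of_bool (v = w))"
    proof (intro sum.cong refl)
      fix v w assume "v \<in> {..<n}" "w \<in> {..<n}"
      then have "(\<Sum>l<n. e l v * cnj (e l w)) = of_bool (v = w)" using e_compl by simp
      then show "cnj (e k v) * e m w * ((\<Sum>l<n. e l v * cnj (e l w)) * (\<Sum>b<d. q v a b * q w b f))
        = cnj (e k v) * e m w * (\<Sum>b<d. q v a b * q w b f) * of_bool (v = w)"
        by (simp only: mult_ac)
    qed
    also have "\<dots> = (\<Sum>v<n. cnj (e k v) * e m v * (\<Sum>b<d. q v a b * q v b f))"
      by (rule sum.cong[OF refl], rule sum_of_bool(2)) auto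
    also have "\<dots> = Q x z" using idem b by (simp add: Q_def x)
    finally show "(\<Sum>y\<in>Z. Q x y * Q y z) = Q x z" .
  qed
  have Q_iso: "(\<Sum>y\<in>Z. of_real (ev y) * Q x y * Q y z) = 0" if xz: "x \<in> Z" "z \<in> Z" for x z
  proof -
    obtain k a m f where x: "x = (k,a)" "z = (m,f)" and b: "k < n" "a < d" "m < n" "f < d"
      using xz by (auto simp: Z_def)
    \<comment> \<open>Either \<open>v\<close> and \<open>w\<close> are not adjacent and the first
      factor is zero, or they are and their projections are orthogonal.\<close>
    have "(\<Sum>l<n. of_real (\<kappa> l) * e l v * cnj (e l w)) * (\<Sum>b<d. q v a b * q w b f) = 0"
      if "v < n" "w < n" for v w
      using e_adj[OF that] orth[OF that _ b(2,4)] by (cases "E v w") simp_all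
    then have "(\<Sum>v<n. \<Sum>w<n. cnj (e k v) * e m w *
        ((\<Sum>l<n. of_real (\<kappa> l) * e l v * cnj (e l w)) * (\<Sum>b<d. q v a b * q w b f))) = 0"
      by (intro sum.neutral ballI) (simp only: lessThan_iff mult_zero_right)
    then show ?thesis unfolding x ev_def Q_prod[of "\<lambda>l. of_real (\<kappa> l)"] .
  qed
  \<comment> \<open>All blocks have the same trace \<open>r\<close> and each eigenvector has norm
    one, so \<open>r\<close> is obtained for every eigenvalue separately. This makes the trace
    identities hold for every function of the spectrum.\<close>
  have Q_trace: "(\<Sum>a<d. Re (Q (k,a) (k,a))) = real r" if "k < n" for k
  proof -
    have "(\<Sum>a<d. Q (k,a) (k,a)) = (\<Sum>v<n. cnj (e k v) * e k v * (\<Sum>a<d. q v a a))"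
      unfolding Q_def by (simp add: sum_distrib_left) (rule sum.swap)
    also have "\<dots> = of_nat r * (\<Sum>v<n. e k v * cnj (e k v))"
      using tr by (simp add: sum_distrib_left mult_ac)
    also have "\<dots> = of_real (real r)" using e_orth[OF that that] by simp
    finally have "Re (\<Sum>a<d. Q (k,a) (k,a)) = real r" by (metis Re_complex_of_real)
    then show ?thesis by simp
  qed
  have t_r: "(1 + t) * real r = real d" using r by (simp add: t_def)
  have trace: "(1 + t) * (\<Sum>i | i \<in> Z \<and> A (ev i). h (ev i) * Re (Q i i)) = (\<Sum>i | i \<in> Z \<and> A (ev i). h (ev i))"
    and energy: "(\<Sum>i | i \<in> Z \<and> A (ev i). h (ev i)) = real d * (\<Sum>k | k < n \<and> A (\<kappa> k). h (\<kappa> k))"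
    for A and h :: "real \<Rightarrow> real"
  proof -
    have "(\<Sum>i | i \<in> Z \<and> A (ev i). h (ev i) * Re (Q i i)) = (\<Sum>k | k < n \<and> A (\<kappa> k). h (\<kappa> k) * real r)"
      unfolding Z_def ev_def sum_times_fibre[where h = h and \<kappa> = \<kappa> and n = n and d = d and A = A and G = "\<lambda>i. Re (Q i i)"] using Q_trace by (intro sum.cong refl) simp
    then have *: "(\<Sum>i | i \<in> Z \<and> A (ev i). h (ev i) * Re (Q i i)) = real r * (\<Sum>k | k < n \<and> A (\<kappa> k). h (\<kappa> k))"
      by (simp add: sum_distrib_left mult.commute)
    show **: "(\<Sum>i | i \<in> Z \<and> A (ev i). h (ev i)) = real d * (\<Sum>k | k < n \<and> A (\<kappa> k). h (\<kappa> k))"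
      using sum_times_fibre[where h = h and \<kappa> = \<kappa> and n = n and d = d and A = A and G = "\<lambda>_. 1"] by (simp add: Z_def ev_def sum_distrib_left mult.commute)
    show "(1 + t) * (\<Sum>i | i \<in> Z \<and> A (ev i). h (ev i) * Re (Q i i)) = (\<Sum>i | i \<in> Z \<and> A (ev i). h (ev i))"
      unfolding * ** mult.assoc[symmetric] t_r ..
  qed
  have d: "real d > 0" unfolding t_r[symmetric] using t0 r by (intro mult_pos_pos) auto
  note pos_E = energy[where A = "\<lambda>x. x > 0" and h = "\<lambda>x. x powr p", folded pos]
    and neg_E = energy[where A = "\<lambda>x. x < 0" and h = "\<lambda>x. \<bar>x\<bar> powr p", folded neg]
  note trp = trace[where A = "\<lambda>x. x > 0" and h = "\<lambda>x. x powr p"] and trn = trace[where A = "\<lambda>x. x < 0" and h = "\<lambda>x. \<bar>x\<bar> powr p"]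
  have abs_pos: "(\<Sum>i | i \<in> Z \<and> ev i > 0. \<bar>ev i\<bar> powr p * g i) = (\<Sum>i | i \<in> Z \<and> ev i > 0. ev i powr p * g i)"
    "(\<Sum>i | i \<in> Z \<and> ev i > 0. \<bar>ev i\<bar> powr p) = (\<Sum>i | i \<in> Z \<and> ev i > 0. ev i powr p)"
    "(\<Sum>i | i \<in> Z \<and> ev i < 0. (- ev i) powr p * g i) = (\<Sum>i | i \<in> Z \<and> ev i < 0. \<bar>ev i\<bar> powr p * g i)"
    "(\<Sum>i | i \<in> Z \<and> ev i < 0. (- ev i) powr p) = (\<Sum>i | i \<in> Z \<and> ev i < 0. \<bar>ev i\<bar> powr p)" for g
    by (auto intro!: sum.cong)
  have iso: "\<forall>x\<in>Z. \<forall>z\<in>Z. (\<Sum>y\<in>Z. of_real (ev y) * Q x y * Q y z) = 0"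
    "\<forall>x\<in>Z. \<forall>z\<in>Z. (\<Sum>y\<in>Z. of_real (- ev y) * Q x y * Q y z) = 0"
    using Q_iso by (auto simp: sum_negf)
  note b1 = energy_bound[where ev = ev and P = Q and Z = Z and t = t and p = p, OF finZ Q_herm Q_idem iso(1) t0 p trp trn]
  have b1': "p \<ge> 1 \<Longrightarrow> real d * pos_energy p n E \<le> t powr (p - 1) * (real d * neg_energy p n E)"
    "p < 1 \<Longrightarrow> real d * neg_energy p n E \<le> t powr (1 - p) * (real d * pos_energy p n E)"
    using b1 by (simp_all only: pos_E neg_E)
  have trn': "(1 + t) * (\<Sum>i | i \<in> Z \<and> - ev i > 0. (- ev i) powr p * Re (Q i i))
      = (\<Sum>i | i \<in> Z \<and> - ev i > 0. (- ev i) powr p)"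
    and trp': "(1 + t) * (\<Sum>j | j \<in> Z \<and> - ev j < 0. \<bar>- ev j\<bar> powr p * Re (Q j j))
      = (\<Sum>j | j \<in> Z \<and> - ev j < 0. \<bar>- ev j\<bar> powr p)"
    using trp trn by (simp_all only: abs_pos neg_0_less_iff_less neg_less_0_iff_less abs_minus_cancel)
  note b2 = energy_bound[where ev = "\<lambda>i. - ev i" and P = Q and Z = Z and t = t and p = p, OF finZ Q_herm Q_idem iso(2) t0 p trn' trp']
  have b2': "p \<ge> 1 \<Longrightarrow> real d * neg_energy p n E \<le> t powr (p - 1) * (real d * pos_energy p n E)"
    "p < 1 \<Longrightarrow> real d * pos_energy p n E \<le> t powr (1 - p) * (real d * neg_energy p n E)"
    using b2 by (simp_all only: abs_pos neg_0_less_iff_less neg_less_0_iff_less abs_minus_cancel pos_E neg_E)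
  have "real d * pos_energy p n E \<le> real d * (t powr \<bar>p - 1\<bar> * neg_energy p n E)"
    "real d * neg_energy p n E \<le> real d * (t powr \<bar>p - 1\<bar> * pos_energy p n E)"
    using b1' b2' by (cases "p \<ge> 1"; simp add: mult.left_commute)+
  then show "pos_energy p n E \<le> t powr \<bar>p - 1\<bar> * neg_energy p n E"
    "neg_energy p n E \<le> t powr \<bar>p - 1\<bar> * pos_energy p n E"
    using d by (simp_all only: mult_le_cancel_left_pos)
qed

section \<open>Constructing projective representations\<close>

lemma has_representationI:
  assumes "\<And>v. v < n \<Longrightarrow> orth_projector d (P v)"
    and tr: "\<And>v. v < n \<Longrightarrow> (\<Sum>i<d. P v $$ (i,i)) = of_nat r"
    and "\<And>u v. u < n \<Longrightarrow> v < n \<Longrightarrow> E u v \<Longrightarrow> P u * P v = 0\<^sub>m d d"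
  shows "has_representation n E d r"
proof -
  have "vec_space.rank d (P v) = r" if "v < n" for v
    using idempotent_rank_eq_trace[of "P v" d] assms(1)[OF that] tr[OF that]
    by (simp add: orth_projector_def)
  then show ?thesis using assms unfolding has_representation_def by blast
qed

lemma orth_projectorI:
  assumes "P \<in> carrier_mat d d"
    and "\<And>i j. i < d \<Longrightarrow> j < d \<Longrightarrow> (\<Sum>k<d. P $$ (i,k) * P $$ (k,j)) = P $$ (i,j)"
    and "\<And>i j. i < d \<Longrightarrow> j < d \<Longrightarrow> cnj (P $$ (j,i)) = P $$ (i,j)"
  shows "orth_projector d P"
  unfolding orth_projector_def
proof (intro conjI)
  show "P * P = P"
    using assms(1,2) by (intro eq_matI) (auto simp: scalar_prod_def atLeast0LessThan)
  show "mat_adjoint P = P"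
    using assms(1,3) by (intro eq_matI) (auto simp: mat_adjoint_index mat_adjoint_def mat_of_rows_def)
qed (rule assms(1))

lemma bdd_below_representation_ratios:
  "bdd_below {real d / real r | d r. r > 0 \<and> has_representation n E d r}"
  by (rule bdd_belowI[of _ 0]) auto

lemma projective_rank_le:
  assumes "has_representation n E d r" "r > 0"
  shows "projective_rank n E \<le> real d / real r"
  unfolding projective_rank_def
  using assms by (intro cInf_lower bdd_below_representation_ratios) auto

section \<open>Direct sums of blocks and quantum colourings\<close>

definition block_diag :: "nat \<Rightarrow> nat \<Rightarrow> (nat \<Rightarrow> complex mat) \<Rightarrow> complex mat" where
  "block_diag r d M = mat (r * d) (r * d)
     (\<lambda>(i,j). if i div d = j div d then M (i div d) $$ (i mod d, j mod d) else 0)"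

lemma block_diag_carrier [simp]: "block_diag r d M \<in> carrier_mat (r * d) (r * d)"
  by (simp add: block_diag_def)

lemma sum_blocks:
  fixes f :: "nat \<Rightarrow> 'a::comm_monoid_add"
  shows "(\<Sum>m<r * d. f m) = (\<Sum>k<r. \<Sum>b<d. f (k * d + b))"
proof -
  have "(\<Sum>m<r * d. f m) = (\<Sum>k<r. sum f {k * d..<k * d + d})" by (simp add: sum.nat_group)
  also have "\<dots> = (\<Sum>k<r. \<Sum>b<d. f (k * d + b))"
  proof (rule sum.cong[OF refl])
    fix k
    show "sum f {k * d..<k * d + d} = (\<Sum>b<d. f (k * d + b))"
      using sum.atLeastLessThan_shift_0[of f "k * d" "k * d + d"] by (simp add: atLeast0LessThan)
  qed
  finally show ?thesis .
qed

lemma block_index: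
  assumes "i < r * (d::nat)"
  shows "i div d < r" "i mod d < d"
proof -
  have "d > 0" using assms by (cases d) auto
  then show "i div d < r" "i mod d < d" using assms by (auto simp: less_mult_imp_div_less)
qed

lemma block_diag_mult:
  assumes M: "\<And>k. k < r \<Longrightarrow> M k \<in> carrier_mat d d" and N: "\<And>k. k < r \<Longrightarrow> N k \<in> carrier_mat d d"
  shows "block_diag r d M * block_diag r d N = block_diag r d (\<lambda>k. M k * N k)"
proof (rule eq_matI)
  fix i j assume "i < dim_row (block_diag r d (\<lambda>k. M k * N k))" "j < dim_col (block_diag r d (\<lambda>k. M k * N k))"
  then have ij: "i < r * d" "j < r * d" by (simp_all add: block_diag_def)
  note b = block_index[OF ij(1)] block_index[OF ij(2)]
  have "(block_diag r d M * block_diag r d N) $$ (i,j)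
    = (\<Sum>m<r * d. block_diag r d M $$ (i,m) * block_diag r d N $$ (m,j))"
    using ij by (auto simp: block_diag_def scalar_prod_def atLeast0LessThan intro!: sum.cong)
  also have "\<dots> = (\<Sum>k<r. \<Sum>b<d. of_bool (k = i div d) *
      (of_bool (k = j div d) * (M k $$ (i mod d, b) * N k $$ (b, j mod d))))"
    unfolding sum_blocks
  proof (intro sum.cong refl)
    fix k b assume "k \<in> {..<r}" "b \<in> {..<d}"
    then have "k < r" "b < d" by auto
    have "k * d + b < Suc k * d" using \<open>b < d\<close> by simp
    also have "\<dots> \<le> r * d" using \<open>k < r\<close> by (intro mult_le_mono1) simp
    finally have "k * d + b < r * d" .
    then show "block_diag r d M $$ (i, k * d + b) * block_diag r d N $$ (k * d + b, j)
      = of_bool (k = i div d) * (of_bool (k = j div d) * (M k $$ (i mod d, b) * N k $$ (b, j mod d)))"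
      using ij \<open>b < d\<close> by (auto simp: block_diag_def)
  qed
  also have "\<dots> = (\<Sum>k<r. of_bool (k = i div d) *
      (\<Sum>b<d. of_bool (k = j div d) * (M k $$ (i mod d, b) * N k $$ (b, j mod d))))"
    by (simp only: sum_distrib_left)
  also have "\<dots> = (\<Sum>b<d. of_bool (i div d = j div d) * (M (i div d) $$ (i mod d, b) * N (i div d) $$ (b, j mod d)))"
    by (rule sum_of_bool(3)) (use b in auto)
  also have "\<dots> = block_diag r d (\<lambda>k. M k * N k) $$ (i,j)"
    using ij b M[OF b(1)] N[OF b(1)]
    by (auto simp: block_diag_def scalar_prod_def atLeast0LessThan intro!: sum.cong)
  finally show "(block_diag r d M * block_diag r d N) $$ (i,j) = block_diag r d (\<lambda>k. M k * N k) $$ (i,j)" .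
qed (simp_all add: block_diag_def)

text \<open>The direct sum over the colours of the projections at a vertex has as its trace the
  trace of their sum, the identity, which is \<open>d\<close>. The resulting ratio
  \<open>r * d / d\<close> is the number of colours.\<close>

lemma quantum_coloring_representation:
  fixes P :: "nat \<Rightarrow> nat \<Rightarrow> complex mat"
  assumes proj: "\<forall>v<n. \<forall>k<r. orth_projector d (P v k)"
    and one: "\<forall>v<n. \<forall>i<d. \<forall>j<d. (\<Sum>k\<in>{0..<r}. P v k $$ (i,j)) = (1\<^sub>m d) $$ (i,j)"
    and orth: "\<forall>u<n. \<forall>v<n. E u v \<longrightarrow> (\<forall>k<r. P u k * P v k = 0\<^sub>m d d)"
  shows "has_representation n E (r * d) d"
proof (rule has_representationI[where P = "\<lambda>v. block_diag r d (P v)"])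
  have c: "P v k \<in> carrier_mat d d" and idem: "P v k * P v k = P v k" and adj: "mat_adjoint (P v k) = P v k"
    if "v < n" "k < r" for v k
    using proj that by (auto simp: orth_projector_def)
  have prod: "block_diag r d (P u) * block_diag r d (P v) = block_diag r d (\<lambda>k. P u k * P v k)"
    if "u < n" "v < n" for u v
    using c that by (intro block_diag_mult) auto
  show "orth_projector (r * d) (block_diag r d (P v))" if v: "v < n" for v
    unfolding orth_projector_def
  proof (intro conjI)
    show "block_diag r d (P v) * block_diag r d (P v) = block_diag r d (P v)"
      unfolding prod[OF v v]
      by (rule eq_matI) (auto simp: block_diag_def idem[OF v] block_index)
    show "mat_adjoint (block_diag r d (P v)) = block_diag r d (P v)"
    proof (rule eq_matI)
      fix i j assume "i < dim_row (block_diag r d (P v))" "j < dim_col (block_diag r d (P v))"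
      then have ij: "i < r * d" "j < r * d" by (simp_all add: block_diag_def)
      note b = block_index[OF ij(1)] block_index[OF ij(2)]
      have "cnj (P v k $$ (j mod d, i mod d)) = P v k $$ (i mod d, j mod d)" if "k < r" for k
        using mat_adjoint_index[OF c[OF v that] b(2,4)] adj[OF v that] by simp
      then show "mat_adjoint (block_diag r d (P v)) $$ (i,j) = block_diag r d (P v) $$ (i,j)"
        using ij b by (subst mat_adjoint_index[OF block_diag_carrier ij]) (auto simp: block_diag_def)
    qed (simp_all add: block_diag_def mat_adjoint_def)
  qed simp
  show "(\<Sum>i<r * d. block_diag r d (P v) $$ (i,i)) = of_nat d" if v: "v < n" for v
  proof -
    have "(\<Sum>i<r * d. block_diag r d (P v) $$ (i,i)) = (\<Sum>i<r * d. P v (i div d) $$ (i mod d, i mod d))"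
      by (intro sum.cong refl) (simp add: block_diag_def)
    also have "\<dots> = (\<Sum>k<r. \<Sum>b<d. P v k $$ (b,b))" unfolding sum_blocks by simp
    also have "\<dots> = (\<Sum>b<d. \<Sum>k\<in>{0..<r}. P v k $$ (b,b))" by (subst sum.swap) (simp add: atLeast0LessThan)
    also have "\<dots> = (\<Sum>b<d. 1)" using one v by (intro sum.cong refl) simp
    finally show ?thesis by simp
  qed
  show "block_diag r d (P u) * block_diag r d (P v) = 0\<^sub>m (r * d) (r * d)"
    if "u < n" "v < n" "E u v" for u v
    unfolding prod[OF that(1,2)]
    using orth that by (intro eq_matI) (auto simp: block_diag_def block_index)
qed

text \<open>Each vector is replaced by the rank one projection onto its span; the product of two of
  these contains the inner product of the vectors as a factor.\<close>

lemma orthogonal_vectors_representation: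
  fixes x :: "nat \<Rightarrow> complex vec"
  assumes x: "\<forall>v<n. x v \<in> carrier_vec d \<and> x v \<noteq> 0\<^sub>v d"
    and orth: "\<forall>u<n. \<forall>v<n. E u v \<longrightarrow> x v \<bullet>c x u = 0"
  shows "has_representation n E d 1"
proof -
  define N where "N v = x v \<bullet>c x v" for v
  have N: "N v \<noteq> 0" if "v < n" for v using conjugate_square_eq_0_vec[of "x v" d] x that by (auto simp: N_def)
  have inner: "(\<Sum>k<d. x u $ k * cnj (x v $ k)) = x u \<bullet>c x v" if "u < n" "v < n" for u v
    using x that by (auto simp: scalar_prod_def atLeast0LessThan intro!: sum.cong)
  have cN: "cnj (N v) = N v" if "v < n" for v
    unfolding N_def inner[OF that that, symmetric] by (simp add: mult.commute)
  define P where "P v = mat d d (\<lambda>(i,j). x v $ i * cnj (x v $ j) / N v)" for v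
  have P_prod: "(\<Sum>k<d. P u $$ (i,k) * P v $$ (k,j)) = x u $ i * cnj (x v $ j) * (x v \<bullet>c x u) / (N u * N v)"
    if "u < n" "v < n" "i < d" "j < d" for u v i j
    unfolding inner[OF that(2,1), symmetric] sum_distrib_left sum_divide_distrib
    using that by (intro sum.cong refl) (simp add: P_def)
  show ?thesis
  proof (rule has_representationI[where P = P])
    show "orth_projector d (P v)" if "v < n" for v
    proof (rule orth_projectorI)
      show "(\<Sum>k<d. P v $$ (i,k) * P v $$ (k,j)) = P v $$ (i,j)" if "i < d" "j < d" for i j
        using P_prod[OF \<open>v < n\<close> \<open>v < n\<close> that] N[OF \<open>v < n\<close>] that by (simp add: P_def N_def)
      show "cnj (P v $$ (j,i)) = P v $$ (i,j)" if "i < d" "j < d" for i j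
        using that cN[OF \<open>v < n\<close>] by (simp add: P_def mult.commute)
    qed (simp add: P_def)
    show "(\<Sum>i<d. P v $$ (i,i)) = of_nat 1" if "v < n" for v
    proof -
      have "(\<Sum>i<d. P v $$ (i,i)) = (\<Sum>i<d. x v $ i * cnj (x v $ i)) / N v"
        by (simp add: P_def sum_divide_distrib)
      then show ?thesis unfolding inner[OF that that] using N[OF that] by (simp add: N_def)
    qed
    show "P u * P v = 0\<^sub>m d d" if "u < n" "v < n" "E u v" for u v
    proof (rule eq_matI)
      fix i j assume "i < dim_row (0\<^sub>m d d :: complex mat)" "j < dim_col (0\<^sub>m d d :: complex mat)"
      then have ij: "i < d" "j < d" by auto
      have "(P u * P v) $$ (i,j) = (\<Sum>k<d. P u $$ (i,k) * P v $$ (k,j))"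
        using ij by (auto simp: P_def scalar_prod_def atLeast0LessThan intro!: sum.cong)
      also have "\<dots> = 0" using P_prod[OF that(1,2) ij] orth that by simp
      finally show "(P u * P v) $$ (i,j) = 0\<^sub>m d d $$ (i,j)" using ij by simp
    qed (auto simp: P_def)
  qed
qed

section \<open>Coordinate projections and fractional colourings\<close>

text \<open>Uses the diagonal projections onto the coordinates in \<open>S v\<close>; their products
  are the projections onto intersections.\<close>

lemma disjoint_sets_representation:
  assumes S: "\<And>v. v < n \<Longrightarrow> S v \<subseteq> {..<d}" "\<And>v. v < n \<Longrightarrow> card (S v) = r"
    and disj: "\<And>u v. u < n \<Longrightarrow> v < n \<Longrightarrow> E u v \<Longrightarrow> S u \<inter> S v = {}"
  shows "has_representation n E d r"
proof -
  define P :: "nat \<Rightarrow> complex mat"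
    where "P v = mat d d (\<lambda>(i,j). of_bool (i \<in> S v) * of_bool (i = j))" for v
  have P_prod: "(\<Sum>k<d. P u $$ (i,k) * P v $$ (k,j)) = of_bool (i \<in> S u \<inter> S v) * of_bool (i = j)"
    if "i < d" "j < d" for u v i j
  proof -
    have "(\<Sum>k<d. P u $$ (i,k) * P v $$ (k,j))
      = (\<Sum>k<d. (of_bool (i \<in> S u) * of_bool (k \<in> S v) * of_bool (k = j)) * of_bool (i = k))"
      using that by (intro sum.cong refl) (simp add: P_def)
    also have "\<dots> = of_bool (i \<in> S u) * of_bool (i \<in> S v) * of_bool (i = j)"
      by (rule sum_of_bool(2)) (use that in auto)
    finally show ?thesis by simp
  qed
  show ?thesis
  proof (rule has_representationI[where P = P])
    show "orth_projector d (P v)" for v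
    proof (rule orth_projectorI)
      show "(\<Sum>k<d. P v $$ (i,k) * P v $$ (k,j)) = P v $$ (i,j)" if "i < d" "j < d" for i j
        using P_prod[OF that] that by (simp add: P_def)
      show "cnj (P v $$ (j,i)) = P v $$ (i,j)" if "i < d" "j < d" for i j
        using that by (auto simp: P_def)
    qed (simp add: P_def)
    show "(\<Sum>i<d. P v $$ (i,i)) = of_nat r" if "v < n" for v
    proof -
      have "(\<Sum>i<d. P v $$ (i,i)) = (\<Sum>i<d. of_bool (i \<in> S v))"
        by (intro sum.cong refl) (simp add: P_def)
      also have "\<dots> = of_nat (card ({..<d} \<inter> S v))" by (simp add: Int_def)
      finally show ?thesis using S[OF that] by (simp add: Int_absorb1)
    qed
    show "P u * P v = 0\<^sub>m d d" if "u < n" "v < n" "E u v" for u v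
    proof (rule eq_matI)
      fix i j assume "i < dim_row (0\<^sub>m d d :: complex mat)" "j < dim_col (0\<^sub>m d d :: complex mat)"
      then have ij: "i < d" "j < d" by auto
      have "(P u * P v) $$ (i,j) = (\<Sum>k<d. P u $$ (i,k) * P v $$ (k,j))"
        using ij by (auto simp: P_def scalar_prod_def atLeast0LessThan intro!: sum.cong)
      also have "\<dots> = 0" using P_prod[OF ij] disj[OF that] by (auto simp: disjoint_iff)
      finally show "(P u * P v) $$ (i,j) = 0\<^sub>m d d $$ (i,j)" using ij by simp
    qed (auto simp: P_def)
  qed
qed

lemma finite_independent_sets: "finite (independent_sets n E)"
  by (rule finite_subset[of _ "Pow {0..<n}"]) (auto simp: independent_sets_def)

text \<open>Weights are rounded up to multiples of \<open>1 / N\<close>, and each independent set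
  labels that many coordinates. A vertex takes \<open>N\<close> coordinates whose labels contain it;
  adjacent vertices share no label. Rounding costs at most one coordinate per independent set, so
  the excess over the cover value is at most \<open>card I / N\<close>.\<close>

lemma projective_rank_le_fractional_cover:
  assumes \<sigma>0: "\<forall>J\<in>independent_sets n E. \<sigma> J \<ge> (0::real)"
    and cover: "\<forall>v<n. (\<Sum>J\<in>{J\<in>independent_sets n E. v \<in> J}. \<sigma> J) \<ge> 1"
  shows "projective_rank n E \<le> (\<Sum>J\<in>independent_sets n E. \<sigma> J)"
proof (rule field_le_epsilon)
  define I where "I = independent_sets n E"
  have finI: "finite I" by (simp add: I_def finite_independent_sets)
  fix \<epsilon> :: real assume "\<epsilon> > 0"
  then obtain N :: nat where N: "real (card I) / \<epsilon> < real N" using reals_Archimedean2 by blast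
  have "N > 0"
  proof (rule ccontr)
    assume "\<not> N > 0"
    then have "real (card I) / \<epsilon> < 0" using N by simp
    then show False using \<open>\<epsilon> > 0\<close> by (simp add: divide_less_0_iff)
  qed
  define m where "m J = nat \<lceil>real N * \<sigma> J\<rceil>" for J
  have m: "real N * \<sigma> J \<le> real (m J)" "real (m J) \<le> real N * \<sigma> J + 1" if "J \<in> I" for J
  proof -
    have "real N * \<sigma> J \<ge> 0" using \<sigma>0 that by (simp add: I_def)
    then show "real N * \<sigma> J \<le> real (m J)" "real (m J) \<le> real N * \<sigma> J + 1"
      unfolding m_def by linarith+
  qed
  define T where "T = Sigma I (\<lambda>J. {..<m J})"
  define D where "D = card T"
  have D: "D = (\<Sum>J\<in>I. m J)" unfolding D_def T_def using finI by simp
  have finT: "finite T" unfolding T_def using finI by simp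
  obtain h where h: "bij_betw h {0..<D} T" using ex_bij_betw_nat_finite[OF finT] D_def by auto
  \<comment> \<open>The cover condition supplies at least \<open>N\<close> coordinates containing
    \<open>v\<close>. Exactly \<open>N\<close> are kept, since all ranks must agree.\<close>
  have "\<exists>S. S \<subseteq> {i. i < D \<and> v \<in> fst (h i)} \<and> card S = N" if v: "v < n" for v
  proof -
    have "bij_betw h {i. i < D \<and> v \<in> fst (h i)} {z \<in> T. v \<in> fst z}"
      using h by (auto simp: bij_betw_def intro: inj_on_subset)
    then have "card {i. i < D \<and> v \<in> fst (h i)} = card {z \<in> T. v \<in> fst z}"
      by (rule bij_betw_same_card)
    also have "{z \<in> T. v \<in> fst z} = Sigma {J \<in> I. v \<in> J} (\<lambda>J. {..<m J})" by (auto simp: T_def)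
    also have "card \<dots> = (\<Sum>J\<in>{J\<in>I. v \<in> J}. m J)" using finI by simp
    finally have c: "card {i. i < D \<and> v \<in> fst (h i)} = (\<Sum>J\<in>{J\<in>I. v \<in> J}. m J)" .
    have "real N * 1 \<le> real N * (\<Sum>J\<in>{J\<in>I. v \<in> J}. \<sigma> J)"
      using cover v by (intro mult_left_mono) (auto simp: I_def)
    also have "\<dots> \<le> (\<Sum>J\<in>{J\<in>I. v \<in> J}. real (m J))"
      unfolding sum_distrib_left using m by (intro sum_mono) auto
    finally have "N \<le> card {i. i < D \<and> v \<in> fst (h i)}" unfolding c by (simp flip: of_nat_sum)
    then show ?thesis using obtain_subset_with_card_n by metis
  qed
  then obtain S where S: "\<And>v. v < n \<Longrightarrow> S v \<subseteq> {i. i < D \<and> v \<in> fst (h i)}" "\<And>v. v < n \<Longrightarrow> card (S v) = N"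
    by metis
  have "has_representation n E D N"
  proof (rule disjoint_sets_representation[where S = S])
    show "S v \<subseteq> {..<D}" if "v < n" for v using S(1)[OF that] by auto
    show "S u \<inter> S v = {}" if uv: "u < n" "v < n" "E u v" for u v
    proof (rule ccontr)
      assume "S u \<inter> S v \<noteq> {}"
      then obtain i where i: "i < D" "u \<in> fst (h i)" "v \<in> fst (h i)" using S(1)[OF uv(1)] S(1)[OF uv(2)] by blast
      then have "h i \<in> T" using h by (auto simp: bij_betw_def)
      then have "fst (h i) \<in> independent_sets n E" by (auto simp: T_def I_def)
      then show False using i uv by (auto simp: independent_sets_def)
    qed
  qed (rule S(2))
  then have "projective_rank n E \<le> real D / real N" using \<open>N > 0\<close> by (rule projective_rank_le)
  also have "\<dots> \<le> (real N * (\<Sum>J\<in>I. \<sigma> J) + real (card I)) / real N"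
  proof (rule divide_right_mono)
    have "real D \<le> (\<Sum>J\<in>I. real N * \<sigma> J + 1)" unfolding D of_nat_sum using m by (intro sum_mono) auto
    then show "real D \<le> real N * (\<Sum>J\<in>I. \<sigma> J) + real (card I)"
      by (simp add: sum.distrib sum_distrib_left)
  qed simp
  also have "\<dots> = (\<Sum>J\<in>I. \<sigma> J) + real (card I) / real N" using \<open>N > 0\<close> by (simp add: add_divide_distrib)
  also have "real (card I) / real N \<le> \<epsilon>" using N \<open>N > 0\<close> \<open>\<epsilon> > 0\<close> by (simp add: field_simps)
  finally show "projective_rank n E \<le> (\<Sum>J\<in>independent_sets n E. \<sigma> J) + \<epsilon>" by (simp add: I_def)
qed

section \<open>Comparison with the chromatic number\<close>

text \<open>The least number of colours is attained because giving every vertex its own colour is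
  proper: an edge has distinct ends.\<close>

lemma chromatic_number_coloring:
  assumes "simple_graph n E"
  obtains c where "\<forall>v<n. c v < chromatic_number n E" "\<forall>u<n. \<forall>v<n. E u v \<longrightarrow> c u \<noteq> c v"
proof -
  have "\<exists>c :: nat \<Rightarrow> nat. (\<forall>v<n. c v < n) \<and> (\<forall>u<n. \<forall>v<n. E u v \<longrightarrow> c u \<noteq> c v)"
    using assms by (intro exI[of _ "\<lambda>v. v"]) (auto simp: simple_graph_def)
  from LeastI[of "\<lambda>k. \<exists>c :: nat \<Rightarrow> nat. (\<forall>v<n. c v < k) \<and> (\<forall>u<n. \<forall>v<n. E u v \<longrightarrow> c u \<noteq> c v)", OF this]
  show ?thesis using that unfolding chromatic_number_def by blast
qed

text \<open>Weight one is placed on every colour class, and each class is independent.\<close>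

lemma coloring_fractional_cover:
  assumes c: "\<forall>v<n. c v < k" and proper: "\<forall>u<n. \<forall>v<n. E u v \<longrightarrow> c u \<noteq> c v"
  obtains \<sigma> :: "nat set \<Rightarrow> real" where "\<forall>J\<in>independent_sets n E. \<sigma> J \<ge> 0"
    "\<forall>v<n. (\<Sum>J\<in>{J\<in>independent_sets n E. v \<in> J}. \<sigma> J) \<ge> 1"
    "(\<Sum>J\<in>independent_sets n E. \<sigma> J) \<le> real k"
proof -
  define C where "C a = {v. v < n \<and> c v = a}" for a
  define F where "F = C ` {..<k}"
  define \<sigma> :: "nat set \<Rightarrow> real" where "\<sigma> J = of_bool (J \<in> F)" for J
  have C: "C a \<in> independent_sets n E" for a
    by (auto simp: C_def independent_sets_def dest: proper[rule_format])
  show ?thesis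
  proof
    show "\<forall>J\<in>independent_sets n E. \<sigma> J \<ge> 0" by (simp add: \<sigma>_def)
    show "\<forall>v<n. (\<Sum>J\<in>{J\<in>independent_sets n E. v \<in> J}. \<sigma> J) \<ge> 1"
    proof (intro allI impI)
      fix v assume v: "v < n"
      have "\<sigma> (C (c v)) \<le> (\<Sum>J\<in>{J\<in>independent_sets n E. v \<in> J}. \<sigma> J)"
        using finite_independent_sets[of n E] C v
        by (intro member_le_sum) (auto simp: \<sigma>_def C_def)
      moreover have "\<sigma> (C (c v)) = 1" using c v by (simp add: \<sigma>_def F_def)
      ultimately show "(\<Sum>J\<in>{J\<in>independent_sets n E. v \<in> J}. \<sigma> J) \<ge> 1" by simp
    qed
    have "(\<Sum>J\<in>independent_sets n E. \<sigma> J) = real (card (independent_sets n E \<inter> F))"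
      using finite_independent_sets[of n E] by (simp add: \<sigma>_def Int_def)
    also have "\<dots> \<le> real (card F)"
      by (intro of_nat_mono card_mono) (auto simp: F_def)
    also have "\<dots> \<le> real k" unfolding F_def using card_image_le[of "{..<k}" C] by simp
    finally show "(\<Sum>J\<in>independent_sets n E. \<sigma> J) \<le> real k" .
  qed
qed

lemma frac_chromatic_number_bounds:
  assumes G: "simple_graph n E"
  shows "frac_chromatic_number n E \<le> real (chromatic_number n E)"
    and "projective_rank n E \<le> frac_chromatic_number n E"
proof -
  let ?S = "{(\<Sum>J\<in>independent_sets n E. \<sigma> J) | \<sigma> :: nat set \<Rightarrow> real.
      (\<forall>J\<in>independent_sets n E. \<sigma> J \<ge> 0) \<and>
      (\<forall>v<n. (\<Sum>J\<in>{J\<in>independent_sets n E. v \<in> J}. \<sigma> J) \<ge> 1)}"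
  obtain c where col: "\<forall>v<n. c v < chromatic_number n E" "\<forall>u<n. \<forall>v<n. E u v \<longrightarrow> c u \<noteq> c v"
    by (rule chromatic_number_coloring[OF G]) (rule that)
  obtain \<sigma> :: "nat set \<Rightarrow> real" where \<sigma>: "\<forall>J\<in>independent_sets n E. \<sigma> J \<ge> 0"
    "\<forall>v<n. (\<Sum>J\<in>{J\<in>independent_sets n E. v \<in> J}. \<sigma> J) \<ge> 1"
    "(\<Sum>J\<in>independent_sets n E. \<sigma> J) \<le> real (chromatic_number n E)"
    by (rule coloring_fractional_cover[OF col]) (rule that)
  \<comment> \<open>This value serves twice: it bounds the infimum from above and shows that the set
    is nonempty.\<close>
  have mem: "(\<Sum>J\<in>independent_sets n E. \<sigma> J) \<in> ?S" using \<sigma> by blast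
  have "bdd_below ?S" by (rule bdd_belowI[of _ 0]) (auto intro: sum_nonneg)
  then have "Inf ?S \<le> (\<Sum>J\<in>independent_sets n E. \<sigma> J)" using mem by (intro cInf_lower)
  then show "frac_chromatic_number n E \<le> real (chromatic_number n E)"
    using \<sigma>(3) unfolding frac_chromatic_number_def by linarith
  show "projective_rank n E \<le> frac_chromatic_number n E"
    unfolding frac_chromatic_number_def
  proof (rule cInf_greatest)
    show "?S \<noteq> {}" using mem by blast
    fix s assume "s \<in> ?S"
    then obtain \<tau> where "s = (\<Sum>J\<in>independent_sets n E. \<tau> J)"
      "\<forall>J\<in>independent_sets n E. \<tau> J \<ge> (0::real)"
      "\<forall>v<n. (\<Sum>J\<in>{J\<in>independent_sets n E. v \<in> J}. \<tau> J) \<ge> 1" by blast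
    then show "projective_rank n E \<le> s" using projective_rank_le_fractional_cover by simp
  qed
qed

text \<open>A colouring is a quantum colouring in dimension \<open>1\<close>, with the numbers
  \<open>0\<close> and \<open>1\<close> as projections. It also ensures that the least number of
  colours is attained.\<close>

lemma quantum_chromatic_number_bounds:
  assumes G: "simple_graph n E"
  shows "quantum_chromatic_number n E \<le> chromatic_number n E"
    and "projective_rank n E \<le> real (quantum_chromatic_number n E)"
proof -
  let ?Q = "\<lambda>r. \<exists>d > 0. \<exists>P :: nat \<Rightarrow> nat \<Rightarrow> complex mat.
      (\<forall>v<n. \<forall>k<r. orth_projector d (P v k)) \<and>
      (\<forall>v<n. \<forall>i<d. \<forall>j<d. (\<Sum>k\<in>{0..<r}. P v k $$ (i,j)) = (1\<^sub>m d) $$ (i,j)) \<and>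
      (\<forall>u<n. \<forall>v<n. E u v \<longrightarrow> (\<forall>k<r. P u k * P v k = 0\<^sub>m d d))"
  obtain c where col: "\<forall>v<n. c v < chromatic_number n E" "\<forall>u<n. \<forall>v<n. E u v \<longrightarrow> c u \<noteq> c v"
    by (rule chromatic_number_coloring[OF G]) (rule that)
  note c = col[rule_format]
  define P :: "nat \<Rightarrow> nat \<Rightarrow> complex mat" where "P v k = mat 1 1 (\<lambda>_. of_bool (c v = k))" for v k
  have Q: "?Q (chromatic_number n E)"
  proof (intro exI[of _ "1::nat"] exI[of _ P] conjI allI impI)
    show "orth_projector 1 (P v k)" for v k by (rule orth_projectorI) (auto simp: P_def)
    show "(\<Sum>k\<in>{0..<chromatic_number n E}. P v k $$ (i,j)) = (1\<^sub>m 1) $$ (i,j)"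
      if "v < n" "i < 1" "j < 1" for v i j
      using that c(1)[OF that(1)] by (simp add: P_def)
    show "P u k * P v k = 0\<^sub>m 1 1" if "u < n" "v < n" "E u v" for u v k
      using c(2)[OF that] by (intro eq_matI) (auto simp: P_def scalar_prod_def)
  qed simp
  show "quantum_chromatic_number n E \<le> chromatic_number n E"
    unfolding quantum_chromatic_number_def by (rule Least_le[of ?Q, OF Q])
  have "?Q (quantum_chromatic_number n E)"
    unfolding quantum_chromatic_number_def by (rule LeastI[of ?Q, OF Q])
  then have "\<exists>d>0. has_representation n E (quantum_chromatic_number n E * d) d"
    by (elim exE conjE) (rule exI, rule conjI, assumption, erule (2) quantum_coloring_representation)
  then obtain d where "d > 0" "has_representation n E (quantum_chromatic_number n E * d) d" by blast
  then show "projective_rank n E \<le> real (quantum_chromatic_number n E)"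
    using projective_rank_le[of n E "quantum_chromatic_number n E * d" d] by simp
qed

text \<open>A colouring assigns to each vertex the unit vector of its colour. An optimal system of
  vectors exists for this reason and yields the rank one representation.\<close>

lemma orthogonal_rank_bounds:
  assumes G: "simple_graph n E"
  shows "orthogonal_rank n E \<le> chromatic_number n E"
    and "has_representation n E (orthogonal_rank n E) 1"
proof -
  let ?Q = "\<lambda>d. \<exists>x :: nat \<Rightarrow> complex vec.
      (\<forall>v<n. x v \<in> carrier_vec d \<and> x v \<noteq> 0\<^sub>v d) \<and>
      (\<forall>u<n. \<forall>v<n. E u v \<longrightarrow> x v \<bullet>c x u = 0)"
  obtain c where col: "\<forall>v<n. c v < chromatic_number n E" "\<forall>u<n. \<forall>v<n. E u v \<longrightarrow> c u \<noteq> c v"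
    by (rule chromatic_number_coloring[OF G]) (rule that)
  note c = col[rule_format]
  let ?k = "chromatic_number n E"
  have Q: "?Q ?k"
  proof (intro exI[of _ "\<lambda>v. unit_vec ?k (c v)"] conjI allI impI)
    show "unit_vec ?k (c v) \<noteq> (0\<^sub>v ?k :: complex vec)" if "v < n" for v
      using c(1)[OF that] by (metis index_unit_vec(2) index_zero_vec(1) zero_neq_one)
    show "unit_vec ?k (c v) \<bullet>c (unit_vec ?k (c u) :: complex vec) = 0" if "u < n" "v < n" "E u v" for u v
      using c(1)[OF that(1)] c(1)[OF that(2)] c(2)[OF that]
      by (simp add: scalar_prod_def unit_vec_def) 
  qed simp
  show "orthogonal_rank n E \<le> ?k"
    unfolding orthogonal_rank_def by (rule Least_le[of ?Q, OF Q])
  have "?Q (orthogonal_rank n E)"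
    unfolding orthogonal_rank_def by (rule LeastI[of ?Q, OF Q])
  then show "has_representation n E (orthogonal_rank n E) 1"
    by (elim exE conjE) (rule orthogonal_vectors_representation)
qed

text \<open>The exponent \<open>1 / q\<close> is \<open>0\<close> for \<open>q = 0\<close>, and the ratios are \<open>0\<close> when a denominator vanishes.\<close>

lemma max_ratio_powr_le:
  fixes a b q t :: real
  assumes "a \<ge> 0" "b \<ge> 0" "q \<ge> 0" "t \<ge> 1" "a \<le> t powr q * b" "b \<le> t powr q * a"
  shows "max (a / b) (b / a) powr (1 / q) \<le> t"
proof (cases "q = 0")
  case True
  \<comment> \<open>The power is \<open>0\<close> or \<open>1\<close> here, so
    \<open>t \<ge> 1\<close> closes the case.\<close>
  then show ?thesis using assms(4) by (simp add: powr_def)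
next
  case False
  have "a / b \<le> t powr q" "b / a \<le> t powr q"
    using assms by (auto simp: divide_le_eq)
  then have "max (a / b) (b / a) powr (1 / q) \<le> (t powr q) powr (1 / q)"
    using assms by (intro powr_mono2) (auto simp: le_max_iff_disj)
  also have "\<dots> = t" using False assms by (simp add: powr_powr)
  finally show ?thesis .
qed

theorem theorem1p8:
  fixes p :: real and n :: nat and E :: "nat \<Rightarrow> nat \<Rightarrow> bool"
  assumes "p \<ge> 0" and "simple_graph n E" and "\<exists>u v. E u v"
  shows "\<forall>X \<in> {frac_chromatic_number n E, real (quantum_chromatic_number n E),
                 real (orthogonal_rank n E)}.
           real (chromatic_number n E) \<ge> X \<and> X \<ge> projective_rank n E \<and>
           projective_rank n E \<ge> 1 + (max (pos_energy p n E / neg_energy p n E)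
                                          (neg_energy p n E / pos_energy p n E))
                                     powr (1 / \<bar>p - 1\<bar>)"
proof -
  let ?b = "max (pos_energy p n E / neg_energy p n E) (neg_energy p n E / pos_energy p n E) powr (1 / \<bar>p - 1\<bar>)"
  obtain u v where uv: "E u v" using assms(3) by blast
  note rep = orthogonal_rank_bounds(2)[OF assms(2)]
  have nonneg: "pos_energy p n E \<ge> 0" "neg_energy p n E \<ge> 0"
    by (auto simp: pos_energy_def neg_energy_def Let_def intro!: sum_nonneg)
  have "1 + ?b \<le> projective_rank n E"
    unfolding projective_rank_def
  proof (rule cInf_greatest)
    \<comment> \<open>The orthogonal rank provides a representation, so the infimum is taken over a
      nonempty set.\<close>
    show "{real d / real r | d r. r > 0 \<and> has_representation n E d r} \<noteq> {}"
      using rep by fastforce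
    fix x assume "x \<in> {real d / real r | d r. r > 0 \<and> has_representation n E d r}"
    then obtain d r where x: "x = real d / real r" and r: "r > 0" and dr: "has_representation n E d r"
      by blast
    note bounds = representation_energy_bound[OF dr assms(2) uv r assms(1)]
    have "?b \<le> real d / real r - 1"
      by (rule max_ratio_powr_le[OF nonneg _ bounds]) simp
    then show "1 + ?b \<le> x" unfolding x by simp
  qed
  moreover have "projective_rank n E \<le> real (orthogonal_rank n E)"
    using projective_rank_le[OF rep] by simp
  ultimately show ?thesis
    using frac_chromatic_number_bounds[OF assms(2)] quantum_chromatic_number_bounds[OF assms(2)]
      orthogonal_rank_bounds(1)[OF assms(2)] by auto
qed

end
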